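(* For all double cosets $\mathfrak g,\mathfrak h\in\mathbf K\setminus\mathbf G/\mathbf K$ and all self-dual submodules $Q,T\subset\mathcal H$, $$\chi_{\mathfrak g\star\mathfrak h}(Q,T)=\chi_{\mathfrak g}(Q,T)\,\chi_{\mathfrak h}(Q,T),$$ where the right-hand side is the product of relations.
   Context: Let $p$ be a prime, $\alpha\ge 0$ and $k\ge 1$ integers. $\mathbf G=\mathrm{GL}(\alpha+k\infty,\mathbb Q_p)$ is the group of finitary ($g-1$ has finitely many nonzero entries) invertible block matrices over $\mathbb Q_p$ of size $\alpha+\infty+\dots+\infty$ ($k$ copies of $\infty=\mathbb N$). It is the union of the subgroups $\mathrm{GL}(\alpha+km,\mathbb Q_p)$, where in each of the $k$ infinite blocks only the first $m$ coordinates are involved. $\mathrm O(\infty,\mathbb Z_p)$ is the group of finitary infinite orthogonal matrices with entries in $\mathbb Z_p$, embedded in $\mathbf G$ by $\mathfrak I(u)=\mathrm{diag}(1_\alpha,u,\dots,u)$; its image is $\mathbf K$. Product of double cosets: let $\Theta_N\in\mathrm O(\infty,\mathbb Z_p)$ be the block matrix of size $N+N+\infty$, $\Theta_N=\begin{pmatrix}0&1_N&0\\ 1_N&0&0\\ 0&0&1_\infty\end{pmatrix}$. For $g\in\mathfrak g$, $h\in\mathfrak h$ the double coset $\mathbf K\,g\,\mathfrak I(\Theta_N)\,h\,\mathbf K$ is constant for all sufficiently large $N$, and its eventual value, independent of the choice of $g,h$, is $\mathfrak g\star\mathfrak h$. A submodule means a $\mathbb Z_p$-submodule of a finite-dimensional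 $\mathbb Q_p$-space. If $V$ carries a nondegenerate skew-symmetric bilinear form $B$, a submodule $R\subset V$ is isotropic if $B(v,w)\in\mathbb Z_p$ for all $v,w\in R$, and self-dual if it is maximal isotropic (equivalently, $R=\{w: B(v,w)\in\mathbb Z_p\ \forall v\in R\}$). $\mathcal V=\mathbb Q_p^\alpha\oplus\mathbb Q_p^\alpha$ and $\mathcal H=\mathbb Q_p^k\oplus\mathbb Q_p^k$ carry the standard skew-symmetric forms with matrix $\begin{pmatrix}0&1\\ -1&0\end{pmatrix}$. A vector $x=(x_1^+,\dots,x_k^+,x_1^-,\dots,x_k^-)$ with $x_j^\pm\in\mathbb Q_p^m$ is regarded as an element of $\mathcal H\otimes\mathbb Q_p^m$; for a submodule $Q\subset\mathcal H$, $Q\otimes\mathbb Z_p^m$ is the direct sum of $m$ copies of $Q$, i.e. the set of $x$ such that for each $i=1,\dots,m$ the vector of $i$-th coordinates $(x_{1,i}^+,\dots,x_{k,i}^+,x_{1,i}^-,\dots,x_{k,i}^-)$ lies in $Q$. Characteristic function: let $g\in\mathrm{GL}(\alpha+km,\mathbb Q_p)$ represent the double coset $\mathfrak g$, and let $Q,T\subset\mathcal H$ be self-dual submodules. $\chi_{\mathfrak g}(Q,T)\subset\mathcal V\oplus\mathcal V$ is the set of all $u\oplus v$, $u=u^+\oplus u^-$, $v=v^+\oplus v^-$, for which there exist $x\in Q\otimes\mathbb Z_p^m$, $y\in T\otimes\mathbb Z_p^m$ with $$\begin{pmatrix}v^+\\ y^+\end{pmatrix}=g\begin{pmatrix}u^+\\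 x^+\end{pmatrix},\qquad \begin{pmatrix}v^-\\ y^-\end{pmatrix}=(g^t)^{-1}\begin{pmatrix}u^-\\ x^-\end{pmatrix},$$ where $x^\pm=(x_1^\pm,\dots,x_k^\pm)$, $y^\pm=(y_1^\pm,\dots,y_k^\pm)$ are columns. It depends only on $\mathfrak g$, not on $m$ or the representative $g$. Relations: a relation $P:V\rightrightarrows W$ is a submodule $P\subset V\oplus W$. For $P:V\rightrightarrows W$ and $S:W\rightrightarrows Y$, the product $SP:V\rightrightarrows Y$ is the set of all $v\oplus y$ for which there is $w\in W$ with $v\oplus w\in P$ and $w\oplus y\in S$. The set $\chi_{\mathfrak g}(Q,T)$ is regarded as a relation $\mathcal V\rightrightarrows\mathcal V$ ($u$ in the source, $v$ in the target). *)

theory Defs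
  imports
    "HOL-Algebra.Coset"
    "HOL-Computational_Algebra.Fraction_Field"
    "HOL-Library.Groups_Big_Fun"
    "HOL-Library.Function_Algebras"
    "HOL-Library.Product_Plus"
    "Berlekamp_Zassenhaus.Finite_Field"
begin

text \<open>
  The prime is a type parameter: \<open>p = CARD('p)\<close> for \<open>'p :: prime_card\<close>.
  The ring of \<open>p\<close>-adic integers is the inverse limit of the rings \<open>\<int>/p\<^sup>n\<close>, a \<open>p\<close>-adic integer
  being the sequence of its representatives in \<open>{0..<p\<^sup>n}\<close>; \<open>\<rat>\<^sub>p\<close> is its field of fractions.
\<close>

abbreviation pp :: "'p::prime_card itself \<Rightarrow> nat \<Rightarrow> int" where
  "pp _ n \<equiv> int CARD('p) ^ n"

lemma pp_mod_mod: "(x mod pp TYPE('p::prime_card) (Suc n)) mod pp TYPE('p) n = x mod pp TYPE('p) n"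
  by (rule mod_mod_cancel) simp

typedef (overloaded) ('p::prime_card) padic_int =
    "{f :: nat \<Rightarrow> int. \<forall>n. f n = f (Suc n) mod pp TYPE('p) n}"
  morphisms padic_res Abs_padic_int
  by (rule exI[of _ "\<lambda>_. 0"]) simp

setup_lifting type_definition_padic_int

lemma padic_res_Suc: "padic_res (x :: 'p::prime_card padic_int) n = padic_res x (Suc n) mod pp TYPE('p) n"
  using padic_res[of x] by blast

lemma padic_res_mod: "padic_res (x :: 'p::prime_card padic_int) n mod pp TYPE('p) n = padic_res x n"
  by (metis mod_mod_trivial padic_res_Suc)

lemma padic_res_add: "padic_res (x :: 'p::prime_card padic_int) (n + m) mod pp TYPE('p) n = padic_res x n"
proof (induction m)
  case 0
  then show ?case by (simp add: padic_res_mod)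
next
  case (Suc m)
  have "padic_res x (n + m) mod pp TYPE('p) n
      = (padic_res x (Suc (n + m)) mod pp TYPE('p) (n + m)) mod pp TYPE('p) n"
    by (simp add: padic_res_Suc[of x "n + m"])
  also have "\<dots> = padic_res x (Suc (n + m)) mod pp TYPE('p) n"
    by (rule mod_mod_cancel) (simp add: power_add)
  finally show ?case using Suc by simp
qed

lemma padic_int_eqI: "(\<And>n. padic_res x n = padic_res y n) \<Longrightarrow> x = y"
  by (simp add: padic_res_inject[symmetric] fun_eq_iff)

instantiation padic_int :: (prime_card) comm_ring_1
begin

lift_definition zero_padic_int :: "'a padic_int" is "\<lambda>_. 0" by simp

lift_definition one_padic_int :: "'a padic_int" is "\<lambda>n. 1 mod pp TYPE('a) n"
  by (unfold pp_mod_mod) simp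

lift_definition plus_padic_int :: "'a padic_int \<Rightarrow> 'a padic_int \<Rightarrow> 'a padic_int"
  is "\<lambda>f g n. (f n + g n) mod pp TYPE('a) n"
  unfolding pp_mod_mod by (intro allI mod_add_cong) (metis mod_mod_trivial)+

lift_definition times_padic_int :: "'a padic_int \<Rightarrow> 'a padic_int \<Rightarrow> 'a padic_int"
  is "\<lambda>f g n. (f n * g n) mod pp TYPE('a) n"
  unfolding pp_mod_mod by (intro allI mod_mult_cong) (metis mod_mod_trivial)+

lift_definition uminus_padic_int :: "'a padic_int \<Rightarrow> 'a padic_int"
  is "\<lambda>f n. (- f n) mod pp TYPE('a) n"
  unfolding pp_mod_mod by (intro allI mod_minus_cong) (metis mod_mod_trivial)

lift_definition minus_padic_int :: "'a padic_int \<Rightarrow> 'a padic_int \<Rightarrow> 'a padic_int"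
  is "\<lambda>f g n. (f n - g n) mod pp TYPE('a) n"
  unfolding pp_mod_mod by (intro allI mod_diff_cong) (metis mod_mod_trivial)+

lemmas padic_res_simps = zero_padic_int.rep_eq one_padic_int.rep_eq plus_padic_int.rep_eq
  times_padic_int.rep_eq uminus_padic_int.rep_eq minus_padic_int.rep_eq

instance
proof
  fix a b c :: "'a padic_int"
  show "a + b + c = a + (b + c)" "a + b = b + a" "- a + a = 0" "a - b = a + - b"
    "a * b * c = a * (b * c)" "a * b = b * a" "(a + b) * c = a * c + b * c"
    by (rule padic_int_eqI, simp add: padic_res_simps mod_simps algebra_simps)+
  show "0 + a = a" "1 * a = a"
    by (rule padic_int_eqI, simp add: padic_res_simps mod_simps padic_res_mod)+
  have "padic_res (1 :: 'a padic_int) 1 \<noteq> padic_res 0 1"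
    using prime_card[where 'a = 'a] by (auto simp: padic_res_simps dest: prime_gt_1_nat)
  then show "(0 :: 'a padic_int) \<noteq> 1"
    by metis
qed

end

lemma prime_pow_dvd_mult:
  fixes q x y :: int
  assumes "prime q" "q ^ (n + m) dvd x * y" "\<not> q ^ m dvd y"
  shows "q ^ n dvd x"
  using assms(2)
proof (induction n arbitrary: x)
  case (Suc n)
  show ?case
  proof (cases "q dvd x")
    case True
    then obtain x' where x: "x = q * x'" by blast
    with Suc.prems have "q ^ (n + m) dvd x' * y"
      using assms(1) by (auto simp: mult.assoc)
    from Suc.IH[OF this] show ?thesis by (simp add: x)
  next
    case False
    then have "coprime (q ^ (Suc n + m)) x"
      using assms(1) by (simp add: prime_imp_coprime)
    with Suc.prems have "q ^ (Suc n + m) dvd y"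
      by (simp only: coprime_dvd_mult_right_iff)
    then have "q ^ m dvd y"
      by (meson dvd_trans le_add2 le_imp_power_dvd)
    with assms(3) show ?thesis by contradiction
  qed
qed simp

instance padic_int :: (prime_card) idom
proof
  fix a b :: "'a padic_int"
  assume "a \<noteq> 0" "b \<noteq> 0"
  then obtain n m where n: "padic_res a n \<noteq> 0" and m: "padic_res b m \<noteq> 0"
    by (metis padic_int_eqI zero_padic_int.rep_eq)
  let ?q = "int CARD('a)"
  have q: "prime ?q" using prime_card[where 'a = 'a] by simp
  show "a * b \<noteq> 0"
  proof
    assume "a * b = 0"
    then have "padic_res (a * b) (n + m) = 0"
      by (simp add: zero_padic_int.rep_eq)
    then have "?q ^ (n + m) dvd padic_res a (n + m) * padic_res b (n + m)"
      by (simp add: times_padic_int.rep_eq dvd_eq_mod_eq_0)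
    moreover have "\<not> ?q ^ m dvd padic_res b (n + m)"
      using m padic_res_add[of b m n] by (simp add: dvd_eq_mod_eq_0 add.commute)
    ultimately have "?q ^ n dvd padic_res a (n + m)"
      by (rule prime_pow_dvd_mult[OF q])
    with n padic_res_add[of a n m] show False by (simp add: dvd_eq_mod_eq_0)
  qed
qed

type_synonym 'p padic = "'p padic_int fract"

definition of_Zp :: "'p::prime_card padic_int \<Rightarrow> 'p padic" where
  "of_Zp a = Fract a 1"

lemma of_Zp_1: "of_Zp 1 = 1"
  by (simp add: of_Zp_def One_fract_def)

lemma of_Zp_add: "of_Zp (a + b) = of_Zp a + of_Zp b"
  by (simp add: of_Zp_def)

lemma of_Zp_mult: "of_Zp (a * b) = of_Zp a * of_Zp b"
  by (simp add: of_Zp_def)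

definition Zp :: "'p::prime_card padic set" where
  "Zp = range of_Zp"

text \<open>
  A matrix with rows and columns indexed by \<open>I\<close> is a function of two indices vanishing outside
  \<open>I \<times> I\<close>. For finitary matrices the sums \<open>\<Sum>l. A i l * B l j\<close> have finite support.
\<close>

definition one_mat :: "'i set \<Rightarrow> 'i \<Rightarrow> 'i \<Rightarrow> 'a::zero_neq_one" where
  "one_mat I i j = (if i = j \<and> i \<in> I then 1 else 0)"

definition mat_mult :: "('i \<Rightarrow> 'i \<Rightarrow> 'a) \<Rightarrow> ('i \<Rightarrow> 'i \<Rightarrow> 'a) \<Rightarrow> 'i \<Rightarrow> 'i \<Rightarrow> 'a::semiring_0" where
  "mat_mult A B i j = (\<Sum>l. A i l * B l j)"

definition mat_vec :: "('i \<Rightarrow> 'i \<Rightarrow> 'a) \<Rightarrow> ('i \<Rightarrow> 'a) \<Rightarrow> 'i \<Rightarrow> 'a::semiring_0" where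
  "mat_vec A v i = (\<Sum>l. A i l * v l)"

definition mat_transpose :: "('i \<Rightarrow> 'i \<Rightarrow> 'a) \<Rightarrow> 'i \<Rightarrow> 'i \<Rightarrow> 'a" where
  "mat_transpose A i j = A j i"

definition finitary_mats :: "'i set \<Rightarrow> ('i \<Rightarrow> 'i \<Rightarrow> 'a::comm_ring_1) set" where
  "finitary_mats I = {A. (\<forall>i j. A i j \<noteq> 0 \<longrightarrow> i \<in> I \<and> j \<in> I) \<and>
     finite {(i, j). A i j \<noteq> one_mat I i j}}"

definition GL :: "'i set \<Rightarrow> ('i \<Rightarrow> 'i \<Rightarrow> 'a::comm_ring_1) monoid" where
  "GL I = units_of \<lparr>carrier = finitary_mats I, monoid.mult = mat_mult, one = one_mat I\<rparr>"

text \<open>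
  Indices of \<open>\<alpha> + \<infinity> + \<dots> + \<infinity>\<close>: \<open>Inl i\<close> is the \<open>i\<close>-th place of the block of size \<open>\<alpha>\<close> and
  \<open>Inr (j, i)\<close> is the \<open>i\<close>-th place of the \<open>j\<close>-th infinite block (all counted from \<open>0\<close>).
\<close>

type_synonym index = "nat + nat \<times> nat"

definition index_set :: "nat \<Rightarrow> nat \<Rightarrow> index set" where
  "index_set \<alpha> k = {..<\<alpha>} <+> ({..<k} \<times> UNIV)"

definition index_level :: "nat \<Rightarrow> nat \<Rightarrow> nat \<Rightarrow> index set" where
  "index_level \<alpha> k m = {..<\<alpha>} <+> ({..<k} \<times> {..<m})"

abbreviation GG :: "nat \<Rightarrow> nat \<Rightarrow> (index \<Rightarrow> index \<Rightarrow> 'p::prime_card padic) monoid" where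
  "GG \<alpha> k \<equiv> GL (index_set \<alpha> k)"

definition GG_level :: "nat \<Rightarrow> nat \<Rightarrow> nat \<Rightarrow> (index \<Rightarrow> index \<Rightarrow> 'p::prime_card padic) set" where
  "GG_level \<alpha> k m = {g \<in> carrier (GG \<alpha> k).
     \<forall>i j. i \<notin> index_level \<alpha> k m \<or> j \<notin> index_level \<alpha> k m \<longrightarrow> g i j = one_mat (index_set \<alpha> k) i j}"

definition O_Zp :: "(nat \<Rightarrow> nat \<Rightarrow> 'p::prime_card padic) set" where
  "O_Zp = {u \<in> finitary_mats UNIV. (\<forall>i j. u i j \<in> Zp) \<and>
     mat_mult u (mat_transpose u) = one_mat UNIV \<and> mat_mult (mat_transpose u) u = one_mat UNIV}"

fun emb :: "nat \<Rightarrow> nat \<Rightarrow> (nat \<Rightarrow> nat \<Rightarrow> 'a::zero_neq_one) \<Rightarrow> index \<Rightarrow> index \<Rightarrow> 'a" where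
  "emb \<alpha> k u (Inl i) (Inl i') = (if i = i' \<and> i < \<alpha> then 1 else 0)"
| "emb \<alpha> k u (Inr (j, i)) (Inr (j', i')) = (if j = j' \<and> j < k then u i i' else 0)"
| "emb \<alpha> k u (Inl _) (Inr _) = 0"
| "emb \<alpha> k u (Inr _) (Inl _) = 0"

definition KK :: "nat \<Rightarrow> nat \<Rightarrow> (index \<Rightarrow> index \<Rightarrow> 'p::prime_card padic) set" where
  "KK \<alpha> k = emb \<alpha> k ` O_Zp"

definition dcoset ::
  "nat \<Rightarrow> nat \<Rightarrow> (index \<Rightarrow> index \<Rightarrow> 'p::prime_card padic) \<Rightarrow> (index \<Rightarrow> index \<Rightarrow> 'p padic) set" where
  "dcoset \<alpha> k g = KK \<alpha> k #>\<^bsub>GG \<alpha> k\<^esub> g <#>\<^bsub>GG \<alpha> k\<^esub> KK \<alpha> k"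

definition double_cosets :: "nat \<Rightarrow> nat \<Rightarrow> (index \<Rightarrow> index \<Rightarrow> 'p::prime_card padic) set set" where
  "double_cosets \<alpha> k = dcoset \<alpha> k ` carrier (GG \<alpha> k)"

definition Theta :: "nat \<Rightarrow> nat \<Rightarrow> nat \<Rightarrow> 'a::zero_neq_one" where
  "Theta N i j =
     (if i < N then (if j = N + i then 1 else 0)
      else if i < 2 * N then (if j = i - N then 1 else 0)
      else (if j = i then 1 else 0))"

text \<open>The value that is eventually attained, for all representatives, by the double coset of
  \<open>g \<Theta>\<^sub>N h\<close>:\<close>

definition star ::
  "nat \<Rightarrow> nat \<Rightarrow> (index \<Rightarrow> index \<Rightarrow> 'p::prime_card padic) set \<Rightarrow>
   (index \<Rightarrow> index \<Rightarrow> 'p padic) set \<Rightarrow> (index \<Rightarrow> index \<Rightarrow> 'p padic) set" where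
  "star \<alpha> k \<gg> \<hh> = (THE D. \<forall>g\<in>\<gg>. \<forall>h\<in>\<hh>. \<forall>\<^sub>F N in sequentially.
     dcoset \<alpha> k (g \<otimes>\<^bsub>GG \<alpha> k\<^esub> emb \<alpha> k (Theta N) \<otimes>\<^bsub>GG \<alpha> k\<^esub> h) = D)"

text \<open>\<open>\<rat>\<^sub>p\<^sup>n\<close> as functions supported on \<open>{..<n}\<close>, and \<open>\<rat>\<^sub>p\<^sup>n \<oplus> \<rat>\<^sub>p\<^sup>n\<close> as pairs \<open>(v\<^sup>+, v\<^sup>-)\<close>:\<close>

type_synonym 'p pvec = "nat \<Rightarrow> 'p padic"

definition Qpn :: "nat \<Rightarrow> 'p::prime_card pvec set" where
  "Qpn n = {v. \<forall>i\<ge>n. v i = 0}"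

definition symp_space :: "nat \<Rightarrow> ('p::prime_card pvec \<times> 'p pvec) set" where
  "symp_space n = Qpn n \<times> Qpn n"

definition symp_form ::
  "nat \<Rightarrow> 'p::prime_card pvec \<times> 'p pvec \<Rightarrow> 'p pvec \<times> 'p pvec \<Rightarrow> 'p padic" where
  "symp_form n v w = (\<Sum>i<n. fst v i * snd w i - snd v i * fst w i)"

definition Zp_scale ::
  "'p::prime_card padic_int \<Rightarrow> 'p pvec \<times> 'p pvec \<Rightarrow> 'p pvec \<times> 'p pvec" where
  "Zp_scale a v = ((\<lambda>i. of_Zp a * fst v i), (\<lambda>i. of_Zp a * snd v i))"

global_interpretation Zp_mod: Modules.module Zp_scale
  defines Zp_submodule = Zp_mod.subspace
proof
  fix a b :: "'a padic_int" and v w :: "'a pvec \<times> 'a pvec"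
  show "Zp_scale a (v + w) = Zp_scale a v + Zp_scale a w"
    by (simp add: Zp_scale_def fun_eq_iff ring_distribs)
  show "Zp_scale (a + b) v = Zp_scale a v + Zp_scale b v"
    by (simp add: Zp_scale_def fun_eq_iff of_Zp_add ring_distribs)
  show "Zp_scale a (Zp_scale b v) = Zp_scale (a * b) v"
    by (simp add: Zp_scale_def fun_eq_iff of_Zp_mult mult.assoc)
  show "Zp_scale 1 v = v"
    by (simp add: Zp_scale_def of_Zp_1)
qed

definition isotropic :: "nat \<Rightarrow> ('p::prime_card pvec \<times> 'p pvec) set \<Rightarrow> bool" where
  "isotropic n R \<longleftrightarrow> (\<forall>v\<in>R. \<forall>w\<in>R. symp_form n v w \<in> Zp)"

definition self_dual :: "nat \<Rightarrow> ('p::prime_card pvec \<times> 'p pvec) set \<Rightarrow> bool" where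
  "self_dual n R \<longleftrightarrow>
     Zp_submodule R \<and> R \<subseteq> symp_space n \<and> isotropic n R \<and>
     (\<forall>R'. Zp_submodule R' \<and> R' \<subseteq> symp_space n \<and> isotropic n R' \<and> R \<subseteq> R' \<longrightarrow> R' = R)"

text \<open>
  An element of \<open>Q \<otimes> \<int>\<^sub>p\<^sup>m\<close> is a pair \<open>(x\<^sup>+, x\<^sup>-)\<close>; the \<open>i\<close>-th coordinate of \<open>x\<^sub>j\<^sup>\<plusminus>\<close> is the value of
  \<open>x\<^sup>\<plusminus>\<close> at \<open>(j, i)\<close>. For \<open>j \<ge> k\<close> it vanishes, as \<open>Q\<close> lies in \<open>symp_space k\<close>.
\<close>

definition tensor_Zp ::
  "('p::prime_card pvec \<times> 'p pvec) set \<Rightarrow> nat \<Rightarrow>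
   ((nat \<times> nat \<Rightarrow> 'p padic) \<times> (nat \<times> nat \<Rightarrow> 'p padic)) set" where
  "tensor_Zp Q m = {(xp, xm).
     (\<forall>i<m. ((\<lambda>j. xp (j, i)), (\<lambda>j. xm (j, i))) \<in> Q) \<and>
     (\<forall>i\<ge>m. \<forall>j. xp (j, i) = 0 \<and> xm (j, i) = 0)}"

text \<open>The column with components \<open>u\<close> and \<open>x\<close> is \<open>case_sum u x\<close>.\<close>

definition chi_rep ::
  "nat \<Rightarrow> nat \<Rightarrow> nat \<Rightarrow> (index \<Rightarrow> index \<Rightarrow> 'p::prime_card padic) \<Rightarrow>
   ('p pvec \<times> 'p pvec) set \<Rightarrow> ('p pvec \<times> 'p pvec) set \<Rightarrow>
   (('p pvec \<times> 'p pvec) \<times> ('p pvec \<times> 'p pvec)) set" where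
  "chi_rep \<alpha> k m g Q T =
     {((up, um), (vp, vm)) | up um vp vm.
       (up, um) \<in> symp_space \<alpha> \<and> (vp, vm) \<in> symp_space \<alpha> \<and>
       (\<exists>(xp, xm) \<in> tensor_Zp Q m. \<exists>(yp, ym) \<in> tensor_Zp T m.
          case_sum vp yp = mat_vec g (case_sum up xp) \<and>
          case_sum vm ym = mat_vec (inv\<^bsub>GG \<alpha> k\<^esub> (mat_transpose g)) (case_sum um xm))}"

text \<open>The common value of \<open>chi_rep\<close> over all representatives in all \<open>GL(\<alpha> + km, \<rat>\<^sub>p)\<close>:\<close>

definition chi ::
  "nat \<Rightarrow> nat \<Rightarrow> (index \<Rightarrow> index \<Rightarrow> 'p::prime_card padic) set \<Rightarrow>
   ('p pvec \<times> 'p pvec) set \<Rightarrow> ('p pvec \<times> 'p pvec) set \<Rightarrow>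
   (('p pvec \<times> 'p pvec) \<times> ('p pvec \<times> 'p pvec)) set" where
  "chi \<alpha> k \<gg> Q T = (THE R. \<forall>m. \<forall>g \<in> \<gg> \<inter> GG_level \<alpha> k m. chi_rep \<alpha> k m g Q T = R)"

text \<open>The product \<open>S P\<close> of relations applies \<open>P\<close> first, whereas \<open>relcomp\<close> composes from left to
  right.\<close>

definition relation_product :: "('b \<times> 'c) set \<Rightarrow> ('a \<times> 'b) set \<Rightarrow> ('a \<times> 'c) set" where
  "relation_product S P = P O S"

end

theory Submission
  imports Defs
begin

text \<open>
  Let \<open>g, h\<close> have level \<open>N\<close>. The double coset of \<open>g \<Theta>\<^sub>N h\<close> is the stable one: orthogonal
  factors of level \<open>M \<le> N\<close> between \<open>g\<close> and \<open>h\<close> become, after conjugation by \<open>\<Theta>\<^sub>N\<close>, matrices fixing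
  the first \<open>M\<close> coordinates of each infinite block; these commute with matrices of level \<open>M\<close> and so
  can be pulled out into \<open>K\<close>. For the same reason \<open>N\<close> does not matter once \<open>N \<ge> 2 M\<close>: \<open>\<Theta>\<^sub>N\<close> and \<open>\<Theta>\<^sub>M\<close>
  differ by permutations fixing the first \<open>M\<close> coordinates.

  Write \<open>x = (x\<^sub>1, x\<^sub>2)\<close>, where \<open>x\<^sub>1\<close> and \<open>x\<^sub>2\<close> consist of the first and second \<open>N\<close> coordinates of each
  block. If \<open>h\<close> maps \<open>(u, x\<^sub>1)\<close> to \<open>(w, z)\<close> and \<open>g\<close> maps \<open>(w, x\<^sub>2)\<close> to \<open>(v, y)\<close>, then
  \<open>g \<Theta>\<^sub>N h\<close> maps \<open>(u, x\<^sub>1, x\<^sub>2)\<close> to \<open>(v, y, z)\<close>. The conditions \<open>x\<^sub>1, x\<^sub>2 \<in> Q \<otimes> \<int>\<^sub>p\<^sup>N\<close> and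
  \<open>y, z \<in> T \<otimes> \<int>\<^sub>p\<^sup>N\<close> are precisely those in the product of the two relations. The contragredient is
  a homomorphism that fixes \<open>K\<close>, so the minus components behave in the same way.
\<close>

section \<open>Sums with finite support\<close>

lemma Sum_any_eq_sum:
  assumes "finite S" "\<And>l. l \<notin> S \<Longrightarrow> f l = 0"
  shows "Sum_any f = sum f S"
  using assms by (intro Sum_any.expand_superset) auto

lemma Sum_any_eq_single:
  assumes "\<And>l. l \<noteq> a \<Longrightarrow> f l = 0"
  shows "Sum_any f = f a"
  using Sum_any_eq_sum[of "{a}" f] assms by simp

lemma Sum_any_reindex:
  assumes "inj r" "\<And>l. l \<notin> range r \<Longrightarrow> f l = 0"
  shows "Sum_any f = Sum_any (\<lambda>b. f (r b))"
proof -
  have "{l. f l \<noteq> 0} = r ` {b. f (r b) \<noteq> 0}"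
    using assms(2) by fast
  moreover have "inj_on r {b. f (r b) \<noteq> 0}"
    using assms(1) by (rule inj_on_subset) simp
  ultimately show ?thesis
    by (simp add: Sum_any.expand_set sum.reindex)
qed

section \<open>Finitary matrices\<close>

text \<open>Rows and columns share one index set \<open>S\<close>, which may be infinite: finite
  sets describe finitary matrices, and \<open>{M..}\<close> describes matrices fixing the first
  \<open>M\<close> coordinates.\<close>

definition mats_on :: "'i set \<Rightarrow> 'i set \<Rightarrow> ('i \<Rightarrow> 'i \<Rightarrow> 'a::zero_neq_one) set" where
  "mats_on I S = {A. \<forall>i j. i \<notin> S \<or> j \<notin> S \<longrightarrow> A i j = one_mat I i j}"

lemma mats_onD: "A \<in> mats_on I S \<Longrightarrow> i \<notin> S \<or> j \<notin> S \<Longrightarrow> A i j = one_mat I i j"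
  by (simp add: mats_on_def)

lemma mats_on_mono: "A \<in> mats_on I S \<Longrightarrow> S \<subseteq> S' \<Longrightarrow> A \<in> mats_on I S'"
  unfolding mats_on_def by blast

lemma one_mat_mats_on: "one_mat I \<in> mats_on I S"
  by (simp add: mats_on_def)

text \<open>Collecting the row and column indices of all exceptional entries gives one finite set
  \<open>S\<close>, over which products become finite sums.\<close>

lemma finitary_mats_iff:
  "A \<in> finitary_mats I \<longleftrightarrow> (\<exists>S. finite S \<and> S \<subseteq> I \<and> A \<in> mats_on I S)"
proof
  assume A: "A \<in> finitary_mats I"
  define E where "E = {(i, j). A i j \<noteq> one_mat I i j}"
  have "finite E" using A by (simp add: E_def finitary_mats_def)
  \<comment> \<open>Outside \<open>I\<close> both \<open>A\<close> and \<open>one_mat I\<close>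
    vanish, so no exceptional entry has an index there.\<close>
  moreover have "fst ` E \<union> snd ` E \<subseteq> I"
    using A unfolding E_def finitary_mats_def one_mat_def by (force split: if_splits)
  moreover have "A \<in> mats_on I (fst ` E \<union> snd ` E)"
    unfolding mats_on_def E_def by force
  ultimately show "\<exists>S. finite S \<and> S \<subseteq> I \<and> A \<in> mats_on I S"
    by (meson finite_Un finite_imageI)
next
  assume "\<exists>S. finite S \<and> S \<subseteq> I \<and> A \<in> mats_on I S"
  then obtain S where S: "finite S" "S \<subseteq> I" "A \<in> mats_on I S" by blast
  have "{(i, j). A i j \<noteq> one_mat I i j} \<subseteq> S \<times> S"
    using S(3) by (auto simp: mats_on_def)
  with S(1) have "finite {(i, j). A i j \<noteq> one_mat I i j}"
    by (meson finite_SigmaI finite_subset)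
  moreover have "i \<in> I \<and> j \<in> I" if "A i j \<noteq> 0" for i j
    using that S by (cases "i \<in> S \<and> j \<in> S") (auto simp: mats_on_def one_mat_def split: if_splits)
  ultimately show "A \<in> finitary_mats I"
    by (simp add: finitary_mats_def)
qed

lemma one_mat_finitary: "one_mat I \<in> finitary_mats I"
  using one_mat_mats_on[of I "{}"] by (auto simp: finitary_mats_iff)

lemma finitary_mats_common:
  assumes "finite F" "F \<subseteq> finitary_mats I"
  obtains S where "finite S" "S \<subseteq> I" "F \<subseteq> mats_on I S"
proof -
  obtain S where S: "\<And>A. A \<in> F \<Longrightarrow> finite (S A) \<and> S A \<subseteq> I \<and> A \<in> mats_on I (S A)"
    using assms(2) unfolding subset_iff finitary_mats_iff by metis
  show thesis
  proof
    show "finite (\<Union>(S ` F))" "\<Union>(S ` F) \<subseteq> I" using S assms(1) by auto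
    show "F \<subseteq> mats_on I (\<Union>(S ` F))"
    proof
      fix A assume "A \<in> F"
      then show "A \<in> mats_on I (\<Union>(S ` F))"
        using S[of A] by (auto intro: mats_on_mono[of A I "S A"])
    qed
  qed
qed

text \<open>Row \<open>i\<close> of \<open>A\<close> is a row of \<open>one_mat I\<close>, so at
  most the term \<open>l = i\<close> survives; that row is zero if \<open>i\<close> is outside
  \<open>I\<close>.\<close>

lemma mat_mult_row_out:
  fixes A :: "'i \<Rightarrow> 'i \<Rightarrow> 'a::semiring_1"
  assumes "A \<in> mats_on I S" "i \<notin> S"
  shows "mat_mult A B i j = (if i \<in> I then B i j else 0)"
  unfolding mat_mult_def
  by (subst Sum_any_eq_single[of i]) (use assms in \<open>auto simp: mats_on_def one_mat_def\<close>)

lemma mat_mult_col_out: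
  fixes B :: "'i \<Rightarrow> 'i \<Rightarrow> 'a::semiring_1"
  assumes "B \<in> mats_on I S" "j \<notin> S"
  shows "mat_mult A B i j = (if j \<in> I then A i j else 0)"
  unfolding mat_mult_def
  by (subst Sum_any_eq_single[of j]) (use assms in \<open>auto simp: mats_on_def one_mat_def\<close>)

lemma mat_vec_out:
  fixes A :: "'i \<Rightarrow> 'i \<Rightarrow> 'a::semiring_1"
  assumes "A \<in> mats_on I S" "i \<notin> S"
  shows "mat_vec A v i = (if i \<in> I then v i else 0)"
  unfolding mat_vec_def
  by (subst Sum_any_eq_single[of i]) (use assms in \<open>auto simp: mats_on_def one_mat_def\<close>)

lemma mat_mult_mats_on_in:
  fixes A :: "'i \<Rightarrow> 'i \<Rightarrow> 'a::semiring_1"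
  assumes "A \<in> mats_on I S" "finite S" "i \<in> S" "j \<in> S"
  shows "mat_mult A B i j = (\<Sum>l\<in>S. A i l * B l j)"
  unfolding mat_mult_def
  by (rule Sum_any_eq_sum) (use assms in \<open>auto simp: mats_on_def one_mat_def\<close>)

lemma mat_vec_in:
  fixes A :: "'i \<Rightarrow> 'i \<Rightarrow> 'a::semiring_1"
  assumes "A \<in> mats_on I S" "finite S" "i \<in> S"
  shows "mat_vec A v i = (\<Sum>l\<in>S. A i l * v l)"
  unfolding mat_vec_def
  by (rule Sum_any_eq_sum) (use assms in \<open>auto simp: mats_on_def one_mat_def\<close>)

lemma mats_on_mat_mult:
  fixes A :: "'i \<Rightarrow> 'i \<Rightarrow> 'a::semiring_1"
  assumes "A \<in> mats_on I S" "B \<in> mats_on I S"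
  shows "mat_mult A B \<in> mats_on I S"
proof -
  have "mat_mult A B i j = one_mat I i j" if "i \<notin> S \<or> j \<notin> S" for i j
  proof (cases "i \<in> S")
    case False
    with assms show ?thesis
      by (simp add: mat_mult_row_out[of A I S]) (simp add: mats_onD one_mat_def)
  next
    case True
    with that have "j \<notin> S" by blast
    with assms show ?thesis
      by (simp add: mat_mult_col_out[of B I S]) (auto simp: mats_onD one_mat_def)
  qed
  then show ?thesis by (simp add: mats_on_def)
qed

lemma finitary_mats_mult:
  assumes "A \<in> finitary_mats I" "B \<in> finitary_mats I"
  shows "mat_mult A B \<in> finitary_mats I"
  using finitary_mats_common[of "{A, B}" I] assms
  by (simp add: finitary_mats_iff) (metis mats_on_mat_mult)

lemma mat_mult_one_left:
  assumes "A \<in> finitary_mats I"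
  shows "mat_mult (one_mat I) A = A"
proof (intro ext)
  fix i j
  show "mat_mult (one_mat I) A i j = A i j"
    using mat_mult_row_out[OF one_mat_mats_on, of i "{}" I A j] assms
    by (auto simp: finitary_mats_def)
qed

lemma mat_mult_one_right:
  assumes "A \<in> finitary_mats I"
  shows "mat_mult A (one_mat I) = A"
proof (intro ext)
  fix i j
  show "mat_mult A (one_mat I) i j = A i j"
    using mat_mult_col_out[OF one_mat_mats_on, of j "{}" A I i] assms
    by (auto simp: finitary_mats_def)
qed

text \<open>Over a common finite \<open>S\<close> this is an interchange of finite sums. The vector
  may have infinite support, as the untruncated characteristic function requires.\<close>

lemma mat_vec_mult:
  assumes "A \<in> finitary_mats I" "B \<in> finitary_mats I"
  shows "mat_vec (mat_mult A B) v = mat_vec A (mat_vec B v)"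
proof (intro ext)
  fix i
  from assms obtain S where S: "finite S" "S \<subseteq> I" "A \<in> mats_on I S" "B \<in> mats_on I S"
    using finitary_mats_common[of "{A, B}" I] by auto
  have AB: "mat_mult A B \<in> mats_on I S" using S by (simp add: mats_on_mat_mult)
  show "mat_vec (mat_mult A B) v i = mat_vec A (mat_vec B v) i"
  proof (cases "i \<in> S")
    case False
    with S AB show ?thesis by (simp add: mat_vec_out[of _ I S])
  next
    case True
    have "mat_vec (mat_mult A B) v i = (\<Sum>l\<in>S. \<Sum>m\<in>S. A i m * B m l * v l)"
      using S AB True by (simp add: mat_vec_in[of _ I S] mat_mult_mats_on_in[of _ I S] sum_distrib_right)
    also have "\<dots> = (\<Sum>m\<in>S. \<Sum>l\<in>S. A i m * B m l * v l)"
      by (rule sum.swap)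
    also have "\<dots> = mat_vec A (mat_vec B v) i"
      using S True by (simp add: mat_vec_in[of _ I S] sum_distrib_left mult.assoc)
    finally show ?thesis .
  qed
qed

text \<open>Each column of a product is the left factor applied to a column of the right factor, so
  \<open>mat_vec_mult\<close> applies columnwise.\<close>

lemma mat_mult_assoc:
  assumes "A \<in> finitary_mats I" "B \<in> finitary_mats I"
  shows "mat_mult (mat_mult A B) C = mat_mult A (mat_mult B C)"
proof (intro ext)
  fix i j
  have "mat_mult D E i j = mat_vec D (\<lambda>l. E l j) i" for D E :: "'a \<Rightarrow> 'a \<Rightarrow> 'b"
    by (simp add: mat_mult_def mat_vec_def)
  moreover have "(\<lambda>l. mat_mult B C l j) = mat_vec B (\<lambda>l. C l j)"
    by (simp add: mat_mult_def mat_vec_def fun_eq_iff)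
  ultimately show "mat_mult (mat_mult A B) C i j = mat_mult A (mat_mult B C) i j"
    using mat_vec_mult[OF assms] by metis
qed

text \<open>The two matrices act on disjoint sets of coordinates. The sets may be infinite, which is
  needed for tails of orthogonal matrices.\<close>

lemma mats_on_disjoint_commute:
  assumes A: "A \<in> mats_on I S" and B: "B \<in> mats_on I T" and "S \<inter> T = {}"
    and "A \<in> finitary_mats I" "B \<in> finitary_mats I"
  shows "mat_mult A B = mat_mult B (A :: _ \<Rightarrow> _ \<Rightarrow> 'a::comm_ring_1)"
proof (intro ext)
  fix i j
  have out: "A i j = 0 \<and> B i j = 0" if "i \<notin> I \<or> j \<notin> I" for i j
    using that assms(4,5) unfolding finitary_mats_def by blast
  \<comment> \<open>For \<open>l\<close> in \<open>U\<close> the entry \<open>D l j\<close> is an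
    off-diagonal entry of the identity; otherwise \<open>C i l\<close> is one.\<close>
  have cross: "mat_mult C D i j = 0"
    if C: "C \<in> mats_on I U" and D: "D \<in> mats_on I V" and UV: "U \<inter> V = {}" "i \<in> U" "j \<in> V"
    for C D :: "'b \<Rightarrow> 'b \<Rightarrow> 'a" and U V
  proof -
    have "C i l * D l j = 0" for l
    proof (cases "l \<in> U")
      case True
      then have "l \<notin> V" "l \<noteq> j" using UV by auto
      then show ?thesis using mats_onD[OF D, of l j] by (simp add: one_mat_def)
    next
      case False
      then have "i \<noteq> l" using UV by auto
      then show ?thesis using False mats_onD[OF C, of i l] by (simp add: one_mat_def)
    qed
    then show ?thesis by (simp add: mat_mult_def)
  qed
  \<comment> \<open>In the first two cases one factor is the identity at both indices and drops out;
    in the mixed cases both products vanish.\<close>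
  consider "i \<notin> S" "j \<notin> S" | "i \<notin> T" "j \<notin> T" | "i \<in> S" "j \<in> T" | "i \<in> T" "j \<in> S"
    using assms(3) by blast
  then show "mat_mult A B i j = mat_mult B A i j"
  proof cases
    case 1
    with A out show ?thesis
      by (simp add: mat_mult_row_out[of A I S] mat_mult_col_out[of A I S])
  next
    case 2
    with B out show ?thesis
      by (simp add: mat_mult_row_out[of B I T] mat_mult_col_out[of B I T])
  next
    case 3
    then have "i \<notin> T" "j \<notin> S" "i \<noteq> j" using assms(3) by auto
    then show ?thesis
      using 3 A B cross[OF A B]  assms(3)
      by (simp add: mat_mult_row_out[of B I T]) (simp add: mats_onD one_mat_def)
  next
    case 4
    then have "i \<notin> S" "j \<notin> T" "i \<noteq> j" using assms(3) by auto
    then show ?thesis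
      using 4 A B cross[OF B A]  assms(3)
      by (simp add: mat_mult_row_out[of A I S] Int_commute) (simp add: mats_onD one_mat_def)
  qed
qed

section \<open>The finitary general linear group\<close>

lemma finitary_mats_monoid:
  "monoid \<lparr>carrier = finitary_mats I, monoid.mult = mat_mult, one = one_mat I\<rparr>"
  by (rule monoidI) (simp_all add: finitary_mats_mult mat_mult_assoc mat_mult_one_left
      mat_mult_one_right one_mat_finitary)

lemma GL_group: "group (GL I)"
  unfolding GL_def by (rule monoid.units_group[OF finitary_mats_monoid])

lemma GL_mult [simp]: "A \<otimes>\<^bsub>GL I\<^esub> B = mat_mult A B"
  by (simp add: GL_def units_of_def)

lemma GL_mult_closed:
  "A \<in> carrier (GL I) \<Longrightarrow> B \<in> carrier (GL I) \<Longrightarrow> mat_mult A B \<in> carrier (GL I)"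
  using monoid.m_closed[OF group.is_monoid[OF GL_group[of I]], of A B] by simp

lemma GL_one [simp]: "\<one>\<^bsub>GL I\<^esub> = one_mat I"
  by (simp add: GL_def units_of_def)

lemma GL_carrier:
  "A \<in> carrier (GL I) \<longleftrightarrow> A \<in> finitary_mats I \<and>
     (\<exists>B\<in>finitary_mats I. mat_mult A B = one_mat I \<and> mat_mult B A = one_mat I)"
  by (auto simp: GL_def units_of_def Units_def)

lemma GL_finitary: "A \<in> carrier (GL I) \<Longrightarrow> A \<in> finitary_mats I"
  by (simp add: GL_carrier)

text \<open>Rows of the inverse outside \<open>S\<close> are read off from \<open>A B = 1\<close>,
  columns outside \<open>S\<close> from \<open>B A = 1\<close>.\<close>

lemma GL_inv_mats_on:
  assumes "A \<in> carrier (GL I)" "A \<in> mats_on I S"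
  shows "inv\<^bsub>GL I\<^esub> A \<in> mats_on I S"
proof -
  interpret group "GL I" by (rule GL_group)
  let ?B = "inv\<^bsub>GL I\<^esub> A"
  have B: "?B \<in> finitary_mats I" using assms(1) by (intro GL_finitary inv_closed)
  have l: "mat_mult A ?B = one_mat I" and r: "mat_mult ?B A = one_mat I"
    using assms(1) r_inv l_inv by simp_all
  have "?B i j = one_mat I i j" if "i \<notin> S \<or> j \<notin> S" for i j
  proof (cases "i \<in> I \<and> j \<in> I")
    case True
    with that show ?thesis
      using mat_mult_row_out[OF assms(2), of i ?B j] mat_mult_col_out[OF assms(2), of j ?B i] l r
      by auto
  next
    case False
    then show ?thesis using B by (auto simp: finitary_mats_def one_mat_def)
  qed
  then show ?thesis by (simp add: mats_on_def)
qed

section \<open>Transposes and contragredients\<close>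

lemma mat_transpose_transpose [simp]: "mat_transpose (mat_transpose A) = A"
  by (simp add: mat_transpose_def fun_eq_iff)

lemma mat_transpose_mult:
  "mat_transpose (mat_mult A B) = mat_mult (mat_transpose B) (mat_transpose (A :: _ \<Rightarrow> _ \<Rightarrow> 'a::comm_ring_1))"
  by (simp add: mat_transpose_def mat_mult_def fun_eq_iff mult.commute)

lemma mat_transpose_one [simp]: "mat_transpose (one_mat I) = one_mat I"
  by (auto simp: mat_transpose_def one_mat_def fun_eq_iff)

lemma mat_transpose_mats_on: "A \<in> mats_on I S \<Longrightarrow> mat_transpose A \<in> mats_on I S"
  by (auto simp: mat_transpose_def mats_on_def one_mat_def)

lemma mat_transpose_finitary: "A \<in> finitary_mats I \<Longrightarrow> mat_transpose A \<in> finitary_mats I"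
  unfolding finitary_mats_iff by (metis mat_transpose_mats_on)

lemma mat_transpose_GL: "A \<in> carrier (GL I) \<Longrightarrow> mat_transpose A \<in> carrier (GL I)"
  unfolding GL_carrier by (metis mat_transpose_finitary mat_transpose_mult mat_transpose_one)

text \<open>The inverse transpose, which acts on the minus components in the characteristic
  function.\<close>

definition contragredient :: "'i set \<Rightarrow> ('i \<Rightarrow> 'i \<Rightarrow> 'a) \<Rightarrow> 'i \<Rightarrow> 'i \<Rightarrow> 'a::comm_ring_1" where
  "contragredient I A = inv\<^bsub>GL I\<^esub> (mat_transpose A)"

lemma contragredient_GL: "A \<in> carrier (GL I) \<Longrightarrow> contragredient I A \<in> carrier (GL I)"
  by (simp add: contragredient_def group.inv_closed[OF GL_group] mat_transpose_GL)

lemma contragredient_mats_on: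
  "A \<in> carrier (GL I) \<Longrightarrow> A \<in> mats_on I S \<Longrightarrow> contragredient I A \<in> mats_on I S"
  by (simp add: contragredient_def GL_inv_mats_on mat_transpose_GL mat_transpose_mats_on)

text \<open>Transposition and inversion both reverse products, so their composite preserves the
  order.\<close>

lemma contragredient_mult:
  assumes "A \<in> carrier (GL I)" "B \<in> carrier (GL I)"
  shows "contragredient I (mat_mult A B) = mat_mult (contragredient I A) (contragredient I B)"
  using group.inv_mult_group[OF GL_group mat_transpose_GL[OF assms(2)] mat_transpose_GL[OF assms(1)]]
  by (simp add: contragredient_def mat_transpose_mult)

text \<open>In a group a left inverse is also a right inverse, so \<open>A\<close> is the inverse of
  its transpose.\<close>

lemma contragredient_orthogonal:
  assumes "A \<in> carrier (GL I)" "mat_mult (mat_transpose A) A = one_mat I"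
  shows "contragredient I A = A"
proof -
  interpret group "GL I" by (rule GL_group)
  have "mat_mult A (mat_transpose A) = one_mat I"
    using inv_comm[of "mat_transpose A" A] assms mat_transpose_GL[OF assms(1)] by simp
  then show ?thesis
    unfolding contragredient_def
    using assms inv_equality[of A "mat_transpose A"] mat_transpose_GL[OF assms(1)] by simp
qed

section \<open>The group \<open>O(\<infinity>, \<int>\<^sub>p)\<close> and its embedding\<close>

lemma Zp_zero: "0 \<in> Zp" and Zp_one: "1 \<in> Zp"
proof -
  show "1 \<in> Zp" unfolding Zp_def by (metis of_Zp_1 rangeI)
  have "of_Zp 0 = 0" by (simp add: of_Zp_def Zero_fract_def)
  then show "0 \<in> Zp" unfolding Zp_def by (metis rangeI)
qed

lemma Zp_add: "a \<in> Zp \<Longrightarrow> b \<in> Zp \<Longrightarrow> a + b \<in> Zp"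
  by (auto simp: Zp_def simp flip: of_Zp_add)

lemma Zp_mult: "a \<in> Zp \<Longrightarrow> b \<in> Zp \<Longrightarrow> a * b \<in> Zp"
  by (auto simp: Zp_def simp flip: of_Zp_mult)

lemma Zp_sum: "(\<And>i. i \<in> S \<Longrightarrow> f i \<in> Zp) \<Longrightarrow> sum f S \<in> Zp"
  by (induction S rule: infinite_finite_induct) (auto simp: Zp_zero Zp_add)

lemma O_ZpD:
  assumes "u \<in> O_Zp"
  shows "u \<in> finitary_mats UNIV" "u i j \<in> Zp"
    "mat_mult u (mat_transpose u) = one_mat UNIV" "mat_mult (mat_transpose u) u = one_mat UNIV"
  using assms by (auto simp: O_Zp_def)

lemma O_Zp_level:
  assumes "u \<in> O_Zp"
  obtains M where "u \<in> mats_on UNIV {..<M}"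
proof -
  obtain S where "finite S" "u \<in> mats_on UNIV S"
    using O_ZpD(1)[OF assms] by (auto simp: finitary_mats_iff)
  moreover from \<open>finite S\<close> obtain M where "S \<subseteq> {..<M}"
    by (meson finite_nat_iff_bounded)
  ultimately show thesis using that mats_on_mono by blast
qed

lemma O_Zp_transpose: "u \<in> O_Zp \<Longrightarrow> mat_transpose u \<in> O_Zp"
  using mat_transpose_finitary by (force simp: O_Zp_def mat_transpose_def)

lemma O_Zp_one: "one_mat UNIV \<in> O_Zp"
  by (simp add: O_Zp_def mat_mult_one_left one_mat_finitary) (simp add: one_mat_def Zp_zero Zp_one)

lemma O_Zp_mult:
  assumes "u \<in> O_Zp" "v \<in> O_Zp"
  shows "mat_mult u v \<in> O_Zp"
proof -
  \<comment> \<open>No finiteness of the support has to be checked: a sum over an infinite set is 0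
    by convention, and 0 lies in \<open>Zp\<close>.\<close>
  have entries: "mat_mult u v i j \<in> Zp" for i j
    unfolding mat_mult_def Sum_any.expand_set
    by (intro Zp_sum Zp_mult O_ZpD(2) assms)
  note fin = O_ZpD(1)[OF assms(1)] O_ZpD(1)[OF assms(2)]
  note orth = O_ZpD(3,4)[OF assms(1)] O_ZpD(3,4)[OF assms(2)]
  note tfin = fin[THEN mat_transpose_finitary]
  have "mat_mult (mat_mult u v) (mat_mult (mat_transpose v) (mat_transpose u))
      = mat_mult u (mat_mult (mat_mult v (mat_transpose v)) (mat_transpose u))"
    by (simp add: mat_mult_assoc[of _ UNIV] fin tfin)
  also have "\<dots> = one_mat UNIV"
    by (simp add: orth mat_mult_one_left[OF tfin(1)])
  finally have 1: "mat_mult (mat_mult u v) (mat_mult (mat_transpose v) (mat_transpose u)) = one_mat UNIV" .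
  have "mat_mult (mat_mult (mat_transpose v) (mat_transpose u)) (mat_mult u v)
      = mat_mult (mat_transpose v) (mat_mult (mat_mult (mat_transpose u) u) v)"
    by (simp add: mat_mult_assoc[of _ UNIV] fin tfin)
  also have "\<dots> = one_mat UNIV"
    by (simp add: orth mat_mult_one_left[OF fin(2)])
  finally show ?thesis
    using 1 entries fin by (simp add: O_Zp_def mat_transpose_mult finitary_mats_mult)
qed

section \<open>The block-diagonal embedding\<close>

lemma emb_one: "emb \<alpha> k (one_mat UNIV) = one_mat (index_set \<alpha> k)"
proof (intro ext)
  fix i j show "emb \<alpha> k (one_mat UNIV) i j = one_mat (index_set \<alpha> k) i j"
    by (cases "(\<alpha>, k, one_mat UNIV :: nat \<Rightarrow> nat \<Rightarrow> 'a, i, j)" rule: emb.cases)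
      (auto simp: one_mat_def index_set_def)
qed

lemma emb_transpose: "mat_transpose (emb \<alpha> k u) = emb \<alpha> k (mat_transpose u)"
proof (intro ext)
  fix i j show "mat_transpose (emb \<alpha> k u) i j = emb \<alpha> k (mat_transpose u) i j"
    by (cases "(\<alpha>, k, u, i, j)" rule: emb.cases) (auto simp: mat_transpose_def)
qed

text \<open>The block of size \<open>\<alpha>\<close> does not occur in the index set, since the
  embedding is the identity on it.\<close>

lemma emb_mats_on:
  assumes "u \<in> mats_on UNIV S"
  shows "emb \<alpha> k u \<in> mats_on (index_set \<alpha> k) (Inr ` ({..<k} \<times> S))"
proof -
  have "emb \<alpha> k u i j = one_mat (index_set \<alpha> k) i j"
    if "i \<notin> Inr ` ({..<k} \<times> S) \<or> j \<notin> Inr ` ({..<k} \<times> S)" for i j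
    using assms that
    by (cases "(\<alpha>, k, u, i, j)" rule: emb.cases)
      (auto simp: one_mat_def index_set_def mats_on_def inj_image_mem_iff)
  then show ?thesis by (simp add: mats_on_def)
qed

lemma emb_finitary:
  assumes "u \<in> finitary_mats UNIV"
  shows "emb \<alpha> k u \<in> finitary_mats (index_set \<alpha> k)"
proof -
  obtain S where "finite S" "u \<in> mats_on UNIV S"
    using assms by (auto simp: finitary_mats_iff)
  then show ?thesis
    unfolding finitary_mats_iff
    by (intro exI[of _ "Inr ` ({..<k} \<times> S)"] conjI emb_mats_on) (auto simp: index_set_def)
qed

lemma Sum_any_Inl:
  assumes "\<And>a. l \<noteq> a \<Longrightarrow> f (Inl a) = 0" "\<And>b. f (Inr b) = 0"
  shows "Sum_any f = f (Inl l)"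
  by (rule Sum_any_eq_single) (metis assms sum.exhaust)

lemma Sum_any_Inr_block:
  fixes f :: "index \<Rightarrow> 'a::comm_monoid_add"
  assumes "\<And>a. f (Inl a) = 0" "\<And>j' i. j' \<noteq> j \<Longrightarrow> f (Inr (j', i)) = 0"
  shows "Sum_any f = Sum_any (\<lambda>i. f (Inr (j, i)))"
proof (rule Sum_any_reindex[of "\<lambda>i. Inr (j, i)"])
  show "f l = 0" if "l \<notin> range (\<lambda>i. Inr (j, i))" for l
    using that assms by (cases l) auto
qed (simp add: inj_def)

text \<open>The hypothesis on \<open>w\<close> and the zero for \<open>j \<ge> k\<close> reflect
  that the embedded matrix annihilates coordinates outside
  \<open>index_set \<alpha> k\<close>.\<close>

lemma emb_vec:
  fixes w :: "nat \<Rightarrow> 'a::comm_ring_1"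
  assumes "\<And>i. i \<ge> \<alpha> \<Longrightarrow> w i = 0"
  shows "mat_vec (emb \<alpha> k u) (case_sum w x)
    = case_sum w (\<lambda>(j, i). if j < k then mat_vec u (\<lambda>l. x (j, l)) i else 0)"
proof (intro ext)
  fix i :: index
  show "mat_vec (emb \<alpha> k u) (case_sum w x) i
    = case_sum w (\<lambda>(j, i). if j < k then mat_vec u (\<lambda>l. x (j, l)) i else 0) i"
  proof (cases i)
    case (Inl a)
    then show ?thesis
      unfolding mat_vec_def by (subst Sum_any_Inl[of a]) (use assms in auto)
  next
    case (Inr q)
    obtain j b where "q = (j, b)" by fastforce
    then show ?thesis
      unfolding mat_vec_def by (subst Sum_any_Inr_block[of _ j]) (use Inr in auto)
  qed
qed

lemma emb_mult:
  "emb \<alpha> k (mat_mult u v) = mat_mult (emb \<alpha> k u) (emb \<alpha> k (v :: _ \<Rightarrow> _ \<Rightarrow> 'a::comm_ring_1))"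
proof (intro ext)
  fix i j :: index
  show "emb \<alpha> k (mat_mult u v) i j = mat_mult (emb \<alpha> k u) (emb \<alpha> k v) i j"
  proof (cases i)
    case (Inl a)
    then show ?thesis
      unfolding mat_mult_def
      by (subst Sum_any_Inl[of a], simp, simp, cases "(\<alpha>, k, v, i, j)" rule: emb.cases) auto
  next
    case (Inr q)
    obtain j' b where q: "q = (j', b)" by fastforce
    \<comment> \<open>Row \<open>(j', b)\<close> meets only block \<open>j'\<close>, so the sum
      shrinks to one copy of the naturals.\<close>
    have "mat_mult (emb \<alpha> k u) (emb \<alpha> k v) i j = (\<Sum>l. (if j' < k then u b l else 0) * emb \<alpha> k v (Inr (j', l)) j)"
      unfolding mat_mult_def by (subst Sum_any_Inr_block[of _ j']) (use Inr q in auto)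
    also have "\<dots> = emb \<alpha> k (mat_mult u v) i j"
    proof (cases j)
      case Inr': (Inr r)
      obtain ja ba where "r = (ja, ba)" by fastforce
      then show ?thesis
        using Inr Inr' q by (cases "j' < k"; cases "j' = ja") (simp_all add: mat_mult_def)
    qed (use Inr q in simp)
    finally show ?thesis by simp
  qed
qed

lemma emb_orthogonal:
  assumes "u \<in> O_Zp"
  shows "mat_mult (emb \<alpha> k u) (emb \<alpha> k (mat_transpose u)) = one_mat (index_set \<alpha> k)"
    and "mat_mult (emb \<alpha> k (mat_transpose u)) (emb \<alpha> k u) = one_mat (index_set \<alpha> k)"
  by (simp_all add: O_ZpD[OF assms] emb_one flip: emb_mult)

lemma emb_GG: "u \<in> O_Zp \<Longrightarrow> emb \<alpha> k u \<in> carrier (GG \<alpha> k)"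
  unfolding GL_carrier
  by (metis O_ZpD(1) O_Zp_transpose emb_finitary emb_orthogonal)

lemma emb_contragredient:
  "u \<in> O_Zp \<Longrightarrow> contragredient (index_set \<alpha> k) (emb \<alpha> k u) = emb \<alpha> k u"
  by (simp add: contragredient_orthogonal emb_GG emb_transpose emb_orthogonal)

lemma KK_subgroup: "subgroup (KK \<alpha> k) (GG \<alpha> k)"
proof
  show "KK \<alpha> k \<subseteq> carrier (GG \<alpha> k)"
    by (auto simp: KK_def emb_GG)
  show "x \<otimes>\<^bsub>GG \<alpha> k\<^esub> y \<in> KK \<alpha> k" if "x \<in> KK \<alpha> k" "y \<in> KK \<alpha> k" for x y
    using that by (auto simp: KK_def O_Zp_mult simp flip: emb_mult)
  show "\<one>\<^bsub>GG \<alpha> k\<^esub> \<in> KK \<alpha> k"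
    by (simp add: KK_def O_Zp_one flip: emb_one)
  show "inv\<^bsub>GG \<alpha> k\<^esub> x \<in> KK \<alpha> k" if x: "x \<in> KK \<alpha> k" for x
  proof -
    obtain u where u: "u \<in> O_Zp" "x = emb \<alpha> k u" using x by (auto simp: KK_def)
    have "inv\<^bsub>GG \<alpha> k\<^esub> x = emb \<alpha> k (mat_transpose u)"
      using u O_Zp_transpose[OF u(1)]
      by (intro group.inv_equality[OF GL_group]) (simp_all add: emb_orthogonal emb_GG)
    then show ?thesis using u by (simp add: KK_def O_Zp_transpose)
  qed
qed

section \<open>Double cosets\<close>

text \<open>One inclusion holds for all \<open>a\<close>, \<open>b\<close>, which are swallowed by
  \<open>K\<close>; applied to \<open>a \<otimes> g \<otimes> b\<close> with the inverse factors it
  yields the other.\<close>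

lemma (in group) double_coset_absorb:
  assumes K: "subgroup K G" and g: "g \<in> carrier G" and "a \<in> K" "b \<in> K"
  shows "K #> (a \<otimes> g \<otimes> b) <#> K = K #> g <#> K"
proof -
  have sub: "K #> (a \<otimes> g \<otimes> b) <#> K \<subseteq> K #> g <#> K"
    if "g \<in> carrier G" "a \<in> K" "b \<in> K" for a b g
  proof
    fix x assume "x \<in> K #> (a \<otimes> g \<otimes> b) <#> K"
    then obtain c d where "c \<in> K" "d \<in> K" "x = (c \<otimes> (a \<otimes> g \<otimes> b)) \<otimes> d"
      by (auto simp: r_coset_def set_mult_def)
    moreover from this have "x = (c \<otimes> a) \<otimes> g \<otimes> (b \<otimes> d)"
      using that subgroup.mem_carrier[OF K] by (simp add: m_assoc)
    ultimately show "x \<in> K #> g <#> K"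
      using that subgroup.m_closed[OF K] unfolding r_coset_def set_mult_def by blast
  qed
  note [simp] = subgroup.mem_carrier[OF K]
  have ia: "inv a \<in> K" and ib: "inv b \<in> K"
    using assms by (simp_all add: subgroup.m_inv_closed[OF K])
  have "inv a \<otimes> (a \<otimes> g \<otimes> b) \<otimes> inv b = (inv a \<otimes> a) \<otimes> g \<otimes> (b \<otimes> inv b)"
    using assms ia ib g by (simp only: m_assoc m_closed subgroup.mem_carrier[OF K])
  also have "\<dots> = g" using assms by simp
  finally have "g = inv a \<otimes> (a \<otimes> g \<otimes> b) \<otimes> inv b" by simp
  then show ?thesis
    using sub[of g a b] sub[of "a \<otimes> g \<otimes> b" "inv a" "inv b"] assms ia ib
    by (metis m_closed subgroup.mem_carrier subset_antisym)
qed

lemma dcoset_iff: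
  "x \<in> dcoset \<alpha> k g \<longleftrightarrow>
     (\<exists>a\<in>O_Zp. \<exists>b\<in>O_Zp. x = mat_mult (mat_mult (emb \<alpha> k a) g) (emb \<alpha> k b))"
  by (auto simp: dcoset_def r_coset_def set_mult_def KK_def)

lemma dcoset_absorb:
  assumes "g \<in> carrier (GG \<alpha> k)" "a \<in> O_Zp" "b \<in> O_Zp"
  shows "dcoset \<alpha> k (mat_mult (mat_mult (emb \<alpha> k a) g) (emb \<alpha> k b)) = dcoset \<alpha> k g"
  using group.double_coset_absorb[OF GL_group KK_subgroup assms(1), of "emb \<alpha> k a" "emb \<alpha> k b"] assms
  by (simp add: dcoset_def KK_def)

lemma dcoset_refl:
  assumes "g \<in> carrier (GG \<alpha> k)"
  shows "g \<in> dcoset \<alpha> k g"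
  unfolding dcoset_iff
  by (intro bexI[of _ "one_mat UNIV"])
    (simp_all add: emb_one mat_mult_one_left mat_mult_one_right GL_finitary assms O_Zp_one)

section \<open>Levels of the group and tails of the orthogonal group\<close>

lemma index_level_mono: "m \<le> n \<Longrightarrow> index_level \<alpha> k m \<subseteq> index_level \<alpha> k n"
  by (auto simp: index_level_def)

lemma finite_index_level: "finite (index_level \<alpha> k m)"
  by (simp add: index_level_def)

lemma GG_level_iff:
  "g \<in> GG_level \<alpha> k m \<longleftrightarrow>
     g \<in> carrier (GG \<alpha> k) \<and> g \<in> mats_on (index_set \<alpha> k) (index_level \<alpha> k m)"
  by (auto simp: GG_level_def mats_on_def)

lemma GG_level_carrier: "g \<in> GG_level \<alpha> k m \<Longrightarrow> g \<in> carrier (GG \<alpha> k)"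
  by (simp add: GG_level_iff)

lemma GG_level_mono: "g \<in> GG_level \<alpha> k m \<Longrightarrow> m \<le> n \<Longrightarrow> g \<in> GG_level \<alpha> k n"
  unfolding GG_level_iff using mats_on_mono index_level_mono by blast

lemma GG_level_contragredient:
  "g \<in> GG_level \<alpha> k m \<Longrightarrow> contragredient (index_set \<alpha> k) g \<in> GG_level \<alpha> k m"
  by (simp add: GG_level_iff contragredient_GL contragredient_mats_on)

lemma GG_level_exhaust:
  assumes "g \<in> carrier (GG \<alpha> k)"
  obtains m where "g \<in> GG_level \<alpha> k m"
proof -
  obtain S where S: "finite S" "S \<subseteq> index_set \<alpha> k" "g \<in> mats_on (index_set \<alpha> k) S"
    using GL_finitary[OF assms] unfolding finitary_mats_iff by blast
  \<comment> \<open>Only places in the infinite blocks constrain the level; indices of the first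
    block are given the harmless place 0.\<close>
  from S(1) have "finite (case_sum (\<lambda>_. 0) snd ` S)" by (rule finite_imageI)
  then obtain m where m: "case_sum (\<lambda>_. 0) snd ` S \<subseteq> {..<m}"
    by (meson finite_nat_iff_bounded)
  have "S \<subseteq> index_level \<alpha> k m"
  proof
    fix s assume s: "s \<in> S"
    then have "s \<in> index_set \<alpha> k" "case_sum (\<lambda>_. 0) snd s < m" using S m by auto
    then show "s \<in> index_level \<alpha> k m"
      by (auto simp: index_set_def index_level_def)
  qed
  with S(3) assms that show thesis
    unfolding GG_level_iff using mats_on_mono by blast
qed

text \<open>The matrices \<open>diag(1, u)\<close> with identity block of size
  \<open>M\<close>.\<close>

definition O_tail :: "nat \<Rightarrow> (nat \<Rightarrow> nat \<Rightarrow> 'p::prime_card padic) set" where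
  "O_tail M = O_Zp \<inter> mats_on UNIV {M..}"

lemma O_tail_commute:
  assumes "u \<in> O_tail M" "g \<in> GG_level \<alpha> k M"
  shows "mat_mult g (emb \<alpha> k u) = mat_mult (emb \<alpha> k u) g"
proof (rule mats_on_disjoint_commute)
  show "g \<in> mats_on (index_set \<alpha> k) (index_level \<alpha> k M)"
    "g \<in> finitary_mats (index_set \<alpha> k)"
    using assms(2) GL_finitary by (auto simp: GG_level_iff)
  show "emb \<alpha> k u \<in> mats_on (index_set \<alpha> k) (Inr ` ({..<k} \<times> {M..}))"
    "emb \<alpha> k u \<in> finitary_mats (index_set \<alpha> k)"
    using assms(1) by (auto simp: O_tail_def emb_mats_on emb_finitary O_ZpD(1))
  show "index_level \<alpha> k M \<inter> Inr ` ({..<k} \<times> {M..}) = {}"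
    by (auto simp: index_level_def)
qed

lemma emb_GG_level:
  assumes "u \<in> O_Zp" "u \<in> mats_on UNIV {..<M}"
  shows "emb \<alpha> k u \<in> GG_level \<alpha> k M"
proof -
  have "emb \<alpha> k u \<in> mats_on (index_set \<alpha> k) (index_level \<alpha> k M)"
    by (rule mats_on_mono[OF emb_mats_on[OF assms(2)]]) (auto simp: index_level_def)
  then show ?thesis using assms(1) by (simp add: GG_level_iff emb_GG)
qed

section \<open>Permutation matrices\<close>

text \<open>With the 1 of row \<open>i\<close> in column \<open>\<pi> i\<close>, the matrix sends a
  vector \<open>v\<close> to \<open>v \<circ> \<pi>\<close>.\<close>

definition perm_mat :: "('i \<Rightarrow> 'i) \<Rightarrow> 'i \<Rightarrow> 'i \<Rightarrow> 'a::zero_neq_one" where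
  "perm_mat \<pi> i j = (if j = \<pi> i then 1 else 0)"

text \<open>Exchanging two general intervals covers both \<open>Theta\<close> and the permutation
  that compares \<open>Theta N\<close> with \<open>Theta M\<close>.\<close>

definition block_swap :: "nat \<Rightarrow> nat \<Rightarrow> nat \<Rightarrow> nat \<Rightarrow> nat" where
  "block_swap a b n i = (if a \<le> i \<and> i < a + n then b + (i - a)
     else if b \<le> i \<and> i < b + n then a + (i - b) else i)"

lemma block_swap_involution: "a + n \<le> b \<Longrightarrow> block_swap a b n (block_swap a b n i) = i"
  by (auto simp: block_swap_def)

lemma Theta_perm_mat: "Theta N = perm_mat (block_swap 0 N N)"
  by (auto simp: Theta_def perm_mat_def block_swap_def fun_eq_iff)

lemma perm_mat_vec: "mat_vec (perm_mat \<pi>) v i = (v (\<pi> i) :: 'a::semiring_1)"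
  unfolding mat_vec_def by (subst Sum_any_eq_single[of "\<pi> i"]) (auto simp: perm_mat_def)

lemma perm_mat_mult_left: "mat_mult (perm_mat \<pi>) u i j = (u (\<pi> i) j :: 'a::semiring_1)"
  unfolding mat_mult_def by (subst Sum_any_eq_single[of "\<pi> i"]) (auto simp: perm_mat_def)

lemma perm_mat_mult_right:
  assumes "\<And>i. \<pi> (\<pi> i) = i"
  shows "mat_mult u (perm_mat \<pi>) i j = (u i (\<pi> j) :: 'a::semiring_1)"
  unfolding mat_mult_def
  by (subst Sum_any_eq_single[of "\<pi> j"]) (use assms in \<open>auto simp: perm_mat_def\<close>)

text \<open>The order is reversed because permutation matrices act on vectors by
  precomposition.\<close>

lemma perm_mat_comp:
  "mat_mult (perm_mat \<pi>) (perm_mat \<rho>) = (perm_mat (\<rho> \<circ> \<pi>) :: _ \<Rightarrow> _ \<Rightarrow> 'a::semiring_1)"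
  by (simp add: fun_eq_iff perm_mat_mult_left) (simp add: perm_mat_def)

text \<open>Injectivity serves the columns: for a fixed point \<open>j\<close>, the equation
  \<open>\<pi> i = j\<close> forces \<open>i = j\<close>.\<close>

lemma perm_mat_mats_on:
  assumes "inj \<pi>" "\<And>i. i \<notin> S \<Longrightarrow> \<pi> i = i"
  shows "perm_mat \<pi> \<in> mats_on UNIV S"
proof -
  have "j = \<pi> i \<longleftrightarrow> i = j" if "i \<notin> S \<or> j \<notin> S" for i j
    using that assms by (metis injD)
  then show ?thesis by (simp add: mats_on_def perm_mat_def one_mat_def)
qed

lemma perm_mat_id: "perm_mat id = one_mat UNIV"
  by (auto simp: fun_eq_iff perm_mat_def one_mat_def)

lemma perm_mat_O_Zp:
  assumes inv: "\<And>i. \<pi> (\<pi> i) = i" and fin: "\<And>i. i \<ge> n \<Longrightarrow> \<pi> i = i"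
  shows "perm_mat \<pi> \<in> (O_Zp :: (nat \<Rightarrow> nat \<Rightarrow> 'a::prime_card padic) set)"
proof -
  let ?P = "perm_mat \<pi> :: nat \<Rightarrow> nat \<Rightarrow> 'a padic"
  have "inj \<pi>" using inv by (metis injI)
  then have "?P \<in> mats_on UNIV {..<n}"
    using fin by (intro perm_mat_mats_on) auto
  then have "?P \<in> finitary_mats UNIV"
    by (auto simp: finitary_mats_iff)
  moreover have "mat_transpose ?P = ?P"
    using inv by (force simp: perm_mat_def mat_transpose_def fun_eq_iff)
  moreover have "mat_mult ?P ?P = one_mat UNIV"
    by (simp add: perm_mat_comp comp_def inv perm_mat_id flip: id_def)
  moreover have "?P i j \<in> Zp" for i j
    by (simp add: perm_mat_def Zp_zero Zp_one)
  ultimately show ?thesis by (simp add: O_Zp_def)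
qed

lemma block_swap_O_Zp: "a + n \<le> b \<Longrightarrow> perm_mat (block_swap a b n) \<in> O_Zp"
  by (rule perm_mat_O_Zp[of _ "b + n"]) (auto simp: block_swap_involution block_swap_def)

lemma Theta_O_Zp: "Theta N \<in> O_Zp"
  by (simp add: Theta_perm_mat block_swap_O_Zp)

lemma Theta_squared: "mat_mult (Theta N) (Theta N) = (one_mat UNIV :: _ \<Rightarrow> _ \<Rightarrow> 'a::comm_ring_1)"
  by (simp add: Theta_perm_mat perm_mat_comp comp_def block_swap_involution perm_mat_id flip: id_def)

section \<open>Stabilisation of the product of double cosets\<close>

text \<open>Conjugation moves the coordinates on which \<open>u\<close> acts from
  \<open>{..<M}\<close> to the \<open>M\<close> places starting at \<open>N\<close>, beyond the
  first \<open>M\<close>.\<close>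

lemma Theta_conj_tail:
  assumes "u \<in> O_Zp" "u \<in> mats_on UNIV {..<M}" "M \<le> N"
  shows "mat_mult (mat_mult (Theta N) u) (Theta N) \<in> O_tail M"
proof -
  have "mat_mult (mat_mult (Theta N) u) (Theta N) i j = u (block_swap 0 N N i) (block_swap 0 N N j)" for i j
    by (simp add: Theta_perm_mat perm_mat_mult_left perm_mat_mult_right block_swap_involution)
  moreover have "u (block_swap 0 N N i) (block_swap 0 N N j) = one_mat UNIV i j" if "i < M \<or> j < M" for i j
    using mats_onD[OF assms(2), of "block_swap 0 N N i" "block_swap 0 N N j"] that assms(3)
    by (auto simp: one_mat_def block_swap_def split: if_splits)
  ultimately have "mat_mult (mat_mult (Theta N) u) (Theta N) \<in> mats_on UNIV {M..}"
    by (auto simp: mats_on_def)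
  then show ?thesis
    using assms(1) by (simp add: O_tail_def O_Zp_mult Theta_O_Zp)
qed

text \<open>\<open>\<sigma>\<close> exchanges the \<open>M\<close>-blocks starting at \<open>M\<close> and \<open>N\<close>. Then \<open>\<Theta>\<^sub>N\<close> followed by \<open>\<sigma>\<close> agrees
  with \<open>\<Theta>\<^sub>M\<close> on the first \<open>M\<close> coordinates, so \<open>\<tau> = \<Theta>\<^sub>N \<sigma> \<Theta>\<^sub>M\<close> fixes these.\<close>

lemma Theta_stable:
  assumes "2 * M \<le> N"
  obtains \<sigma> \<tau> :: "nat \<Rightarrow> nat \<Rightarrow> 'p::prime_card padic"
  where "\<sigma> \<in> O_tail M" "\<tau> \<in> O_tail M" "mat_mult (mat_mult \<sigma> (Theta N)) \<tau> = Theta M"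
proof
  let ?s = "block_swap M N M"
  let ?\<sigma> = "perm_mat ?s :: nat \<Rightarrow> nat \<Rightarrow> 'p padic"
  let ?\<tau> = "mat_mult (mat_mult (Theta N) ?\<sigma>) (Theta M)"
  have s: "?s (?s i) = i" for i using assms by (simp add: block_swap_involution)
  have \<sigma>: "?\<sigma> \<in> O_Zp" using assms by (simp add: block_swap_O_Zp)
  have inj: "inj ?s" "inj (block_swap 0 K K)" for K
    using s block_swap_involution[of 0 K K] by (metis injI, metis injI add_0 order_refl)
  then have "?\<sigma> \<in> mats_on UNIV {M..}"
    using assms by (intro perm_mat_mats_on) (auto simp: block_swap_def)
  with \<sigma> show "?\<sigma> \<in> O_tail M" by (simp add: O_tail_def)
  \<comment> \<open>The three swaps take \<open>i < M\<close> to \<open>N + i\<close>, then to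
    \<open>M + i\<close>, then back to \<open>i\<close>.\<close>
  have "perm_mat (block_swap 0 M M \<circ> (?s \<circ> block_swap 0 N N)) \<in> mats_on UNIV {M..}"
    using inj assms by (intro perm_mat_mats_on inj_compose) (auto simp: block_swap_def)
  then have "?\<tau> \<in> mats_on UNIV {M..}"
    by (simp only: Theta_perm_mat perm_mat_comp)
  with \<sigma> show "?\<tau> \<in> O_tail M" by (simp add: O_tail_def O_Zp_mult Theta_O_Zp)
  \<comment> \<open>All factors are involutions, so both copies of \<open>Theta N\<close> and then
    both copies of the middle permutation cancel.\<close>
  show "mat_mult (mat_mult ?\<sigma> (Theta N)) ?\<tau> = Theta M"
    by (simp add: Theta_perm_mat perm_mat_comp comp_def block_swap_involution s)
qed

text \<open>The factor \<open>a\<close> crosses \<open>t\<close> to the right as \<open>a'\<close>,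
  which then passes \<open>b\<close> and \<open>h\<close>; the factor \<open>b\<close> crosses
  \<open>t\<close> to the left as \<open>b'\<close>, which then passes \<open>g\<close>.\<close>

lemma (in group) commute_past:
  assumes [simp]: "g \<in> carrier G" "h \<in> carrier G" "t \<in> carrier G" "a \<in> carrier G" "b \<in> carrier G"
    "a' \<in> carrier G" "b' \<in> carrier G"
    and "a \<otimes> t = t \<otimes> a'" "t \<otimes> b = b' \<otimes> t"
    and "b \<otimes> a' = a' \<otimes> b" "h \<otimes> a' = a' \<otimes> h" "g \<otimes> b' = b' \<otimes> g"
  shows "(g \<otimes> a) \<otimes> t \<otimes> (b \<otimes> h) = b' \<otimes> (g \<otimes> t \<otimes> h) \<otimes> a'"
proof -
  have "(g \<otimes> a) \<otimes> t \<otimes> (b \<otimes> h) = g \<otimes> (a \<otimes> t) \<otimes> (b \<otimes> h)" by (simp add: m_assoc)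
  also have "\<dots> = g \<otimes> t \<otimes> (a' \<otimes> b) \<otimes> h" by (simp add: assms m_assoc)
  also have "\<dots> = g \<otimes> t \<otimes> (b \<otimes> a') \<otimes> h" by (simp add: assms)
  also have "\<dots> = g \<otimes> (t \<otimes> b) \<otimes> (a' \<otimes> h)" by (simp add: m_assoc)
  also have "\<dots> = g \<otimes> (b' \<otimes> t) \<otimes> (h \<otimes> a')" by (simp add: assms)
  also have "\<dots> = (g \<otimes> b') \<otimes> t \<otimes> h \<otimes> a'" by (simp add: m_assoc)
  also have "\<dots> = (b' \<otimes> g) \<otimes> t \<otimes> h \<otimes> a'" by (simp add: assms)
  also have "\<dots> = b' \<otimes> (g \<otimes> t \<otimes> h) \<otimes> a'" by (simp add: m_assoc)
  finally show ?thesis .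
qed

abbreviation theta_product ::
  "nat \<Rightarrow> nat \<Rightarrow> nat \<Rightarrow> (index \<Rightarrow> index \<Rightarrow> 'p::prime_card padic) \<Rightarrow> (index \<Rightarrow> index \<Rightarrow> 'p padic) \<Rightarrow>
   index \<Rightarrow> index \<Rightarrow> 'p padic" where
  "theta_product \<alpha> k N g h \<equiv> mat_mult (mat_mult g (emb \<alpha> k (Theta N))) h"

lemma theta_product_GG:
  "g \<in> carrier (GG \<alpha> k) \<Longrightarrow> h \<in> carrier (GG \<alpha> k) \<Longrightarrow> theta_product \<alpha> k N g h \<in> carrier (GG \<alpha> k)"
  by (simp add: GL_mult_closed emb_GG Theta_O_Zp)

text \<open>After writing \<open>Theta M\<close> as \<open>\<sigma> \<Theta> \<tau>\<close> with
  \<open>\<Theta> = Theta N\<close>, the embedded \<open>\<sigma>\<close> commutes with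
  \<open>g\<close> and the embedded \<open>\<tau>\<close> with \<open>h\<close>, so both reach the
  outside.\<close>

lemma dcoset_theta_product_stable:
  assumes g: "g \<in> GG_level \<alpha> k M" and h: "h \<in> GG_level \<alpha> k M" and "2 * M \<le> N"
  shows "dcoset \<alpha> k (theta_product \<alpha> k N g h) = dcoset \<alpha> k (theta_product \<alpha> k M g h)"
proof -
  interpret group "GG \<alpha> k" by (rule GL_group)
  obtain \<sigma> \<tau> :: "nat \<Rightarrow> nat \<Rightarrow> 'a padic" where \<sigma>: "\<sigma> \<in> O_tail M" and \<tau>: "\<tau> \<in> O_tail M"
    and eq: "mat_mult (mat_mult \<sigma> (Theta N)) \<tau> = Theta M"
    using Theta_stable[OF assms(3)] by blast
  note carr [simp] = GG_level_carrier[OF g] GG_level_carrier[OF h] emb_GG[OF Theta_O_Zp]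
    emb_GG[OF \<sigma>[unfolded O_tail_def, THEN IntD1]] emb_GG[OF \<tau>[unfolded O_tail_def, THEN IntD1]]
  note assoc = m_assoc[unfolded GL_mult] and closed = m_closed[unfolded GL_mult]
  let ?e = "emb \<alpha> k"
  have "theta_product \<alpha> k M g h = mat_mult (mat_mult (mat_mult g (?e \<sigma>)) (?e (Theta N))) (mat_mult (?e \<tau>) h)"
    by (simp add: emb_mult assoc closed flip: eq)
  also have "\<dots> = mat_mult (mat_mult (?e \<sigma>) (theta_product \<alpha> k N g h)) (?e \<tau>)"
    unfolding O_tail_commute[OF \<sigma> g] O_tail_commute[OF \<tau> h, symmetric]
    by (simp add: assoc closed)
  finally show ?thesis
    using \<sigma> \<tau> by (simp add: dcoset_absorb theta_product_GG O_tail_def)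
qed

lemma dcoset_theta_product_representatives:
  assumes g: "g \<in> GG_level \<alpha> k M" and h: "h \<in> GG_level \<alpha> k M" and "M \<le> N"
    and a: "a \<in> O_Zp" "a \<in> mats_on UNIV {..<M}" and b: "b \<in> O_Zp" "b \<in> mats_on UNIV {..<M}"
  shows "dcoset \<alpha> k (theta_product \<alpha> k N (mat_mult g (emb \<alpha> k a)) (mat_mult (emb \<alpha> k b) h))
    = dcoset \<alpha> k (theta_product \<alpha> k N g h)"
proof -
  interpret group "GG \<alpha> k" by (rule GL_group)
  define a' where "a' = mat_mult (mat_mult (Theta N) a) (Theta N)"
  define b' where "b' = mat_mult (mat_mult (Theta N) b) (Theta N)"
  have a': "a' \<in> O_tail M" and b': "b' \<in> O_tail M"
    unfolding a'_def b'_def using a b assms(3) by (auto intro: Theta_conj_tail)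
  then have O: "a' \<in> O_Zp" "b' \<in> O_Zp" by (simp_all add: O_tail_def)
  let ?e = "emb \<alpha> k"
  note carr [simp] = GG_level_carrier[OF g] GG_level_carrier[OF h] emb_GG[OF Theta_O_Zp]
    O[THEN emb_GG] emb_GG[OF a(1)] emb_GG[OF b(1)]
  note fin = O_ZpD(1)[OF Theta_O_Zp] O_ZpD(1)[OF a(1)] O_ZpD(1)[OF b(1)]
  have "mat_mult (Theta N) a' = mat_mult (mat_mult (Theta N) (Theta N)) (mat_mult a (Theta N))"
    unfolding a'_def by (simp only: mat_mult_assoc[of _ UNIV] finitary_mats_mult fin)
  then have 1: "mat_mult a (Theta N) = mat_mult (Theta N) a'"
    by (simp add: Theta_squared mat_mult_one_left finitary_mats_mult fin)
  have "mat_mult b' (Theta N) = mat_mult (mat_mult (Theta N) b) (mat_mult (Theta N) (Theta N))"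
    unfolding b'_def by (simp only: mat_mult_assoc[of _ UNIV] finitary_mats_mult fin)
  then have 2: "mat_mult (Theta N) b = mat_mult b' (Theta N)"
    by (simp add: Theta_squared mat_mult_one_right finitary_mats_mult fin)
  \<comment> \<open>The embedded \<open>b\<close> itself has level \<open>M\<close>, so the tail
    matrix \<open>a'\<close> commutes with it just as with \<open>h\<close>.\<close>
  have "theta_product \<alpha> k N (mat_mult g (?e a)) (mat_mult (?e b) h)
      = mat_mult (mat_mult (?e b') (theta_product \<alpha> k N g h)) (?e a')"
    using commute_past[of g h "?e (Theta N)" "?e a" "?e b" "?e a'" "?e b'"]
      1[THEN arg_cong, of ?e] 2[THEN arg_cong, of ?e]
      O_tail_commute[OF a' emb_GG_level[OF b]] O_tail_commute[OF a' h] O_tail_commute[OF b' g]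
    by (simp add: emb_mult)
  then show ?thesis by (simp add: dcoset_absorb theta_product_GG O)
qed

text \<open>The outer orthogonal factors are absorbed at once, the inner ones by conjugation with
  \<open>Theta N\<close>; finally \<open>N\<close> is replaced by \<open>M\<close>.\<close>

lemma eventually_dcoset_theta_product:
  assumes g: "g \<in> GG_level \<alpha> k M" and h: "h \<in> GG_level \<alpha> k M"
    and g': "g' \<in> dcoset \<alpha> k g" and h': "h' \<in> dcoset \<alpha> k h"
  shows "\<forall>\<^sub>F N in sequentially.
    dcoset \<alpha> k (theta_product \<alpha> k N g' h') = dcoset \<alpha> k (theta_product \<alpha> k M g h)"
proof -
  interpret group "GG \<alpha> k" by (rule GL_group)
  let ?e = "emb \<alpha> k"
  obtain a b where ab: "a \<in> O_Zp" "b \<in> O_Zp" "g' = mat_mult (mat_mult (?e a) g) (?e b)"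
    using g' unfolding dcoset_iff by blast
  obtain c d where cd: "c \<in> O_Zp" "d \<in> O_Zp" "h' = mat_mult (mat_mult (?e c) h) (?e d)"
    using h' unfolding dcoset_iff by blast
  obtain Mb Mc where "b \<in> mats_on UNIV {..<Mb}" "c \<in> mats_on UNIV {..<Mc}"
    using O_Zp_level ab cd by metis
  \<comment> \<open>At level \<open>L\<close> the inner factors are covered along with
    \<open>g\<close> and \<open>h\<close>, and \<open>N \<ge> 2 * L\<close> gives both
    \<open>L \<le> N\<close> and \<open>2 * M \<le> N\<close>.\<close>
  define L where "L = max M (max Mb Mc)"
  have L: "b \<in> mats_on UNIV {..<L}" "c \<in> mats_on UNIV {..<L}"
    by (rule mats_on_mono, fact, simp add: L_def)+
  have gh: "g \<in> GG_level \<alpha> k L" "h \<in> GG_level \<alpha> k L"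
    using g h by (auto simp: L_def intro: GG_level_mono)
  note carr [simp] = GG_level_carrier[OF g] GG_level_carrier[OF h] emb_GG[OF Theta_O_Zp]
    ab(1,2)[THEN emb_GG] cd(1,2)[THEN emb_GG]
  note assoc = m_assoc[unfolded GL_mult] and closed = m_closed[unfolded GL_mult]
  have "dcoset \<alpha> k (theta_product \<alpha> k N g' h') = dcoset \<alpha> k (theta_product \<alpha> k M g h)"
    if N: "N \<ge> 2 * L" for N
  proof -
    have "theta_product \<alpha> k N g' h'
      = mat_mult (mat_mult (?e a) (theta_product \<alpha> k N (mat_mult g (?e b)) (mat_mult (?e c) h))) (?e d)"
      by (simp add: ab cd assoc closed)
    then have "dcoset \<alpha> k (theta_product \<alpha> k N g' h')
      = dcoset \<alpha> k (theta_product \<alpha> k N (mat_mult g (?e b)) (mat_mult (?e c) h))"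
      using ab cd by (simp add: dcoset_absorb theta_product_GG closed)
    also have "\<dots> = dcoset \<alpha> k (theta_product \<alpha> k N g h)"
      using N gh L ab cd by (intro dcoset_theta_product_representatives[of _ _ _ L]) auto
    also have "\<dots> = dcoset \<alpha> k (theta_product \<alpha> k M g h)"
      using N g h by (intro dcoset_theta_product_stable) (auto simp: L_def)
    finally show ?thesis .
  qed
  then show ?thesis by (auto simp: eventually_sequentially)
qed

text \<open>The value is unique because two eventual values of the same sequence agree at some
  common \<open>N\<close>.\<close>

lemma star_eq:
  assumes g: "g \<in> GG_level \<alpha> k M" and h: "h \<in> GG_level \<alpha> k M"
  shows "star \<alpha> k (dcoset \<alpha> k g) (dcoset \<alpha> k h) = dcoset \<alpha> k (theta_product \<alpha> k M g h)"
  unfolding star_def GL_mult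
proof (rule the_equality)
  show "\<forall>g'\<in>dcoset \<alpha> k g. \<forall>h'\<in>dcoset \<alpha> k h. \<forall>\<^sub>F N in sequentially.
      dcoset \<alpha> k (theta_product \<alpha> k N g' h') = dcoset \<alpha> k (theta_product \<alpha> k M g h)"
    using eventually_dcoset_theta_product[OF assms] by blast
next
  fix D
  assume "\<forall>g'\<in>dcoset \<alpha> k g. \<forall>h'\<in>dcoset \<alpha> k h. \<forall>\<^sub>F N in sequentially.
      dcoset \<alpha> k (theta_product \<alpha> k N g' h') = D"
  moreover have gh: "g \<in> dcoset \<alpha> k g" "h \<in> dcoset \<alpha> k h"
    using assms by (simp_all add: dcoset_refl GG_level_carrier)
  ultimately have "\<forall>\<^sub>F N in sequentially. dcoset \<alpha> k (theta_product \<alpha> k N g h) = D"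
    by blast
  from eventually_conj[OF this eventually_dcoset_theta_product[OF assms gh]]
  obtain N where "dcoset \<alpha> k (theta_product \<alpha> k N g h) = D"
    "dcoset \<alpha> k (theta_product \<alpha> k N g h) = dcoset \<alpha> k (theta_product \<alpha> k M g h)"
    by (auto simp: eventually_sequentially)
  then show "D = dcoset \<alpha> k (theta_product \<alpha> k M g h)" by (rule subst)
qed

section \<open>The characteristic function without truncation\<close>

text \<open>As \<open>g\<close> is finitary, \<open>x\<close> and \<open>y\<close> in the definition of \<open>\<chi>\<close> may be allowed to have infinitely
  many nonzero coordinates; this removes the dependence on the level \<open>m\<close>.\<close>

definition tensor_all ::
  "('p::prime_card pvec \<times> 'p pvec) set \<Rightarrow>
   ((nat \<times> nat \<Rightarrow> 'p padic) \<times> (nat \<times> nat \<Rightarrow> 'p padic)) set" where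
  "tensor_all Q = {(xp, xm). \<forall>i. ((\<lambda>j. xp (j, i)), (\<lambda>j. xm (j, i))) \<in> Q}"

definition char_rel ::
  "nat \<Rightarrow> nat \<Rightarrow> (index \<Rightarrow> index \<Rightarrow> 'p::prime_card padic) \<Rightarrow>
   ('p pvec \<times> 'p pvec) set \<Rightarrow> ('p pvec \<times> 'p pvec) set \<Rightarrow>
   (('p pvec \<times> 'p pvec) \<times> ('p pvec \<times> 'p pvec)) set" where
  "char_rel \<alpha> k g Q T =
     {((u1, u2), (v1, v2)) | u1 u2 v1 v2.
       (u1, u2) \<in> symp_space \<alpha> \<and> (v1, v2) \<in> symp_space \<alpha> \<and>
       (\<exists>xp xm yp ym. (xp, xm) \<in> tensor_all Q \<and> (yp, ym) \<in> tensor_all T \<and>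
          case_sum v1 yp = mat_vec g (case_sum u1 xp) \<and>
          case_sum v2 ym = mat_vec (contragredient (index_set \<alpha> k) g) (case_sum u2 xm))}"

lemma char_rel_iff:
  "((u1, u2), (v1, v2)) \<in> char_rel \<alpha> k g Q T \<longleftrightarrow>
       (u1, u2) \<in> symp_space \<alpha> \<and> (v1, v2) \<in> symp_space \<alpha> \<and>
       (\<exists>xp xm yp ym. (xp, xm) \<in> tensor_all Q \<and> (yp, ym) \<in> tensor_all T \<and>
          case_sum v1 yp = mat_vec g (case_sum u1 xp) \<and>
          case_sum v2 ym = mat_vec (contragredient (index_set \<alpha> k) g) (case_sum u2 xm))"
  by (simp add: char_rel_def)

definition graft ::
  "nat \<Rightarrow> (nat \<times> nat \<Rightarrow> 'a) \<Rightarrow> (nat \<times> nat \<Rightarrow> 'a) \<Rightarrow> nat \<times> nat \<Rightarrow> 'a" where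
  "graft N x r = (\<lambda>(j, i). if i < N then x (j, i) else r (j, i))"

text \<open>Beyond place \<open>N\<close> the matrix is the identity on the first \<open>k\<close>
  infinite blocks, so the tails of input and output may be replaced together. It annihilates blocks
  \<open>j \<ge> k\<close>, hence the condition on \<open>r\<close>.\<close>

lemma mat_vec_graft:
  assumes g: "g \<in> GG_level \<alpha> k N"
    and eq: "case_sum v y = mat_vec g (case_sum u x)"
    and r: "\<And>j i. j \<ge> k \<Longrightarrow> r (j, i) = 0"
  shows "case_sum v (graft N y r) = mat_vec g (case_sum u (graft N x r))"
proof
  fix i
  note on = g[unfolded GG_level_iff, THEN conjunct2]
  show "case_sum v (graft N y r) i = mat_vec g (case_sum u (graft N x r)) i"
  proof (cases "i \<in> index_level \<alpha> k N")
    case True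
    have "case_sum v (graft N y r) i = case_sum v y i"
      using True by (auto simp: index_level_def graft_def)
    also have "\<dots> = (\<Sum>l\<in>index_level \<alpha> k N. g i l * case_sum u x l)"
      unfolding eq by (rule mat_vec_in[OF on finite_index_level True])
    also have "\<dots> = (\<Sum>l\<in>index_level \<alpha> k N. g i l * case_sum u (graft N x r) l)"
      by (rule sum.cong) (auto simp: index_level_def graft_def)
    also have "\<dots> = mat_vec g (case_sum u (graft N x r)) i"
      by (rule mat_vec_in[OF on finite_index_level True, symmetric])
    finally show ?thesis .
  next
    case False
    \<comment> \<open>The old equation is still needed here: at indices outside
      \<open>index_set \<alpha> k\<close> that grafting leaves alone, it says that the left side is
      0.\<close>
    have "case_sum v y i = (if i \<in> index_set \<alpha> k then case_sum u x i else 0)"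
      unfolding eq by (rule mat_vec_out[OF on False])
    moreover have "mat_vec g (case_sum u (graft N x r)) i
      = (if i \<in> index_set \<alpha> k then case_sum u (graft N x r) i else 0)"
      by (rule mat_vec_out[OF on False])
    ultimately show ?thesis
      using False r by (auto simp: index_level_def index_set_def graft_def split: sum.splits if_splits)
  qed
qed

lemma tensor_all_vanish:
  assumes "(xp, xm) \<in> tensor_all Q" "Q \<subseteq> symp_space k" "j \<ge> k"
  shows "xp (j, i) = 0" "xm (j, i) = 0"
proof -
  have "((\<lambda>j. xp (j, i)), (\<lambda>j. xm (j, i))) \<in> symp_space k"
    using assms by (auto simp: tensor_all_def)
  then show "xp (j, i) = 0" "xm (j, i) = 0"
    using assms(3) by (auto simp: symp_space_def Qpn_def)
qed

lemma tensor_all_graft: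
  assumes "(xp, xm) \<in> tensor_all Q" "(rp, rm) \<in> tensor_all Q"
  shows "(graft N xp rp, graft N xm rm) \<in> tensor_all Q"
proof -
  have "((\<lambda>j. graft N xp rp (j, i)), (\<lambda>j. graft N xm rm (j, i))) \<in> Q" for i
    using assms by (cases "i < N") (simp_all add: tensor_all_def graft_def)
  then show ?thesis by (simp add: tensor_all_def)
qed

lemma tensor_all_zero: "Zp_submodule Q \<Longrightarrow> ((\<lambda>_. 0), (\<lambda>_. 0)) \<in> tensor_all Q"
  using Zp_mod.subspace_0[of Q] by (auto simp: tensor_all_def zero_prod_def zero_fun_def)

text \<open>The coordinate vectors beyond \<open>m\<close> are zero, and a submodule contains
  zero.\<close>

lemma tensor_Zp_subset:
  assumes "Zp_submodule Q" "(xp, xm) \<in> tensor_Zp Q m"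
  shows "(xp, xm) \<in> tensor_all Q"
proof -
  have "((\<lambda>j. xp (j, i)), (\<lambda>j. xm (j, i))) \<in> Q" for i
    using assms tensor_all_zero[OF assms(1)]
    by (cases "i < m") (simp_all add: tensor_Zp_def tensor_all_def)
  then show ?thesis by (simp add: tensor_all_def)
qed

lemma tensor_Zp_graft: "(xp, xm) \<in> tensor_all Q \<Longrightarrow>
    (graft m xp (\<lambda>_. 0), graft m xm (\<lambda>_. 0)) \<in> tensor_Zp Q m"
  by (auto simp: tensor_all_def tensor_Zp_def graft_def)

lemma chi_rep_iff:
  "((u1, u2), (v1, v2)) \<in> chi_rep \<alpha> k m g Q T \<longleftrightarrow>
       (u1, u2) \<in> symp_space \<alpha> \<and> (v1, v2) \<in> symp_space \<alpha> \<and>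
       (\<exists>xp xm yp ym. (xp, xm) \<in> tensor_Zp Q m \<and> (yp, ym) \<in> tensor_Zp T m \<and>
          case_sum v1 yp = mat_vec g (case_sum u1 xp) \<and>
          case_sum v2 ym = mat_vec (contragredient (index_set \<alpha> k) g) (case_sum u2 xm))"
  unfolding chi_rep_def contragredient_def by (simp add: case_prod_beta Bex_def)

text \<open>Cutting \<open>x\<close> and \<open>y\<close> off at place \<open>m\<close> preserves
  both equations, because \<open>g\<close> and its contragredient have level
  \<open>m\<close>.\<close>

lemma chi_rep_eq_char_rel:
  assumes g: "g \<in> GG_level \<alpha> k m" and Q: "Zp_submodule Q" and T: "Zp_submodule T"
  shows "chi_rep \<alpha> k m g Q T = char_rel \<alpha> k g Q T"
proof
  show "chi_rep \<alpha> k m g Q T \<subseteq> char_rel \<alpha> k g Q T"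
  proof
    fix z assume z: "z \<in> chi_rep \<alpha> k m g Q T"
    obtain u1 u2 v1 v2 where zeq: "z = ((u1, u2), (v1, v2))" by (metis surj_pair)
    show "z \<in> char_rel \<alpha> k g Q T"
      using z tensor_Zp_subset[OF Q] tensor_Zp_subset[OF T]
      unfolding zeq chi_rep_iff char_rel_iff by blast
  qed
  show "char_rel \<alpha> k g Q T \<subseteq> chi_rep \<alpha> k m g Q T"
  proof
    fix z assume z: "z \<in> char_rel \<alpha> k g Q T"
    obtain u1 u2 v1 v2 where zeq: "z = ((u1, u2), (v1, v2))" by (metis surj_pair)
    from z obtain xp xm yp ym where sp: "(u1, u2) \<in> symp_space \<alpha>" "(v1, v2) \<in> symp_space \<alpha>"
      and x: "(xp, xm) \<in> tensor_all Q" and y: "(yp, ym) \<in> tensor_all T"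
      and p: "case_sum v1 yp = mat_vec g (case_sum u1 xp)"
      and m: "case_sum v2 ym = mat_vec (contragredient (index_set \<alpha> k) g) (case_sum u2 xm)"
      unfolding zeq char_rel_iff by blast
    show "z \<in> chi_rep \<alpha> k m g Q T"
      unfolding zeq chi_rep_iff
      using sp tensor_Zp_graft[OF x, of m] tensor_Zp_graft[OF y, of m]
        mat_vec_graft[OF g p, of "\<lambda>_. 0"]
        mat_vec_graft[OF GG_level_contragredient[OF g] m, of "\<lambda>_. 0"]
      by blast
  qed
qed

section \<open>Invariance under orthogonal matrices\<close>

text \<open>This is \<open>1 \<otimes> u\<close> on the tensor product of the
  \<open>k\<close>-dimensional space with the coordinate space, extended by zero as in
  \<open>emb\<close>.\<close>

definition block_action ::
  "nat \<Rightarrow> (nat \<Rightarrow> nat \<Rightarrow> 'a) \<Rightarrow> (nat \<times> nat \<Rightarrow> 'a) \<Rightarrow> nat \<times> nat \<Rightarrow> 'a::semiring_0" where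
  "block_action k u x = (\<lambda>(j, i). if j < k then mat_vec u (\<lambda>l. x (j, l)) i else 0)"

lemma emb_vec_block_action:
  "w \<in> Qpn \<alpha> \<Longrightarrow> mat_vec (emb \<alpha> k u) (case_sum w x) = case_sum w (block_action k u x)"
  unfolding block_action_def by (rule emb_vec) (simp add: Qpn_def)

lemma sum_fun_apply: "(\<Sum>a\<in>A. f a) x = (\<Sum>a\<in>A. f a x)"
  by (induction A rule: infinite_finite_induct) auto

text \<open>The entries of \<open>u\<close> are \<open>p\<close>-adic integers, so every new
  coordinate vector is a finite integral combination of old ones, all in \<open>Q\<close>.\<close>

lemma tensor_all_block_action:
  assumes x: "(xp, xm) \<in> tensor_all Q" and u: "u \<in> O_Zp"
    and Q: "Zp_submodule Q" "Q \<subseteq> symp_space k"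
  shows "(block_action k u xp, block_action k u xm) \<in> tensor_all Q"
proof -
  have "((\<lambda>j. block_action k u xp (j, i)), (\<lambda>j. block_action k u xm (j, i))) \<in> Q" for i
  proof -
    obtain S where S: "finite S" "u \<in> mats_on UNIV S"
      using O_ZpD(1)[OF u] by (auto simp: finitary_mats_iff)
    \<comment> \<open>Adding \<open>i\<close> to \<open>S\<close> makes the finite-sum formula
      available for row \<open>i\<close>.\<close>
    have on: "u \<in> mats_on UNIV (insert i S)"
      by (rule mats_on_mono[OF S(2)]) blast
    have "\<forall>l. \<exists>b. u i l = of_Zp b"
      using O_ZpD(2)[OF u] by (auto simp: Zp_def)
    then obtain b where b: "\<And>l. u i l = of_Zp (b l)" by metis
    have act: "block_action k u y (j, i) = (\<Sum>l\<in>insert i S. of_Zp (b l) * y (j, l))"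
      if "\<And>j l. j \<ge> k \<Longrightarrow> y (j, l) = 0" for y j
      using that mat_vec_in[OF on, of i "\<lambda>l. y (j, l)"] S(1)
      by (simp add: block_action_def b del: sum.insert_if sum.insert)
    have "((\<lambda>j. block_action k u xp (j, i)), (\<lambda>j. block_action k u xm (j, i)))
      = (\<Sum>l\<in>insert i S. Zp_scale (b l) ((\<lambda>j. xp (j, l)), (\<lambda>j. xm (j, l))))"
      by (intro prod_eqI)
        (simp_all only: fst_conv snd_conv fst_sum snd_sum fun_eq_iff sum_fun_apply Zp_scale_def
          act[of xp] act[of xm] tensor_all_vanish[OF x Q(2)] simp_thms)
    also have "\<dots> \<in> Q"
      using x by (intro Zp_mod.subspace_sum Zp_mod.subspace_scale Q(1)) (simp add: tensor_all_def)
    finally show ?thesis .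
  qed
  then show ?thesis by (simp add: tensor_all_def)
qed

text \<open>If \<open>x\<close>, \<open>y\<close> are witnesses for \<open>g\<close>, then the
  transpose of \<open>b\<close> applied to \<open>x\<close>, and \<open>a\<close> applied to
  \<open>y\<close>, are witnesses for \<open>a g b\<close>.\<close>

lemma char_rel_subset_translate:
  assumes g: "g \<in> carrier (GG \<alpha> k)" and a: "a \<in> O_Zp" and b: "b \<in> O_Zp"
    and Q: "Zp_submodule Q" "Q \<subseteq> symp_space k" and T: "Zp_submodule T" "T \<subseteq> symp_space k"
  shows "char_rel \<alpha> k g Q T \<subseteq> char_rel \<alpha> k (mat_mult (mat_mult (emb \<alpha> k a) g) (emb \<alpha> k b)) Q T"
proof
  fix z assume z: "z \<in> char_rel \<alpha> k g Q T"
  let ?e = "emb \<alpha> k" and ?c = "contragredient (index_set \<alpha> k)"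
  \<comment> \<open>Stated for an arbitrary \<open>f\<close>, to be used for \<open>g\<close> and
    for its contragredient.\<close>
  have move: "case_sum v (block_action k a y)
      = mat_vec (mat_mult (mat_mult (?e a) f) (?e b)) (case_sum u (block_action k (mat_transpose b) x))"
    if f: "f \<in> carrier (GG \<alpha> k)" and uv: "u \<in> Qpn \<alpha>" "v \<in> Qpn \<alpha>"
      and eq: "case_sum v y = mat_vec f (case_sum u x)" for f u v x y
  proof -
    note fin = O_ZpD(1)[OF a, THEN emb_finitary, of \<alpha> k] O_ZpD(1)[OF b, THEN emb_finitary, of \<alpha> k]
      O_ZpD(1)[OF O_Zp_transpose[OF b], THEN emb_finitary, of \<alpha> k] GL_finitary[OF f]
    have "mat_vec (mat_mult (mat_mult (?e a) f) (?e b)) (case_sum u (block_action k (mat_transpose b) x))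
      = mat_vec (mat_mult (mat_mult (?e a) f) (?e b)) (mat_vec (?e (mat_transpose b)) (case_sum u x))"
      by (simp add: emb_vec_block_action uv)
    also have "\<dots> = mat_vec (?e a) (mat_vec f (mat_vec (mat_mult (?e b) (?e (mat_transpose b))) (case_sum u x)))"
      by (simp add: mat_vec_mult[of _ "index_set \<alpha> k"] finitary_mats_mult fin)
    also have "\<dots> = mat_vec (?e a) (mat_vec (mat_mult f (one_mat (index_set \<alpha> k))) (case_sum u x))"
      by (simp add: emb_orthogonal[OF b] mat_vec_mult[of _ "index_set \<alpha> k"] fin one_mat_finitary)
    also have "\<dots> = case_sum v (block_action k a y)"
      by (simp add: mat_mult_one_right fin uv emb_vec_block_action flip: eq)
    finally show ?thesis by simp
  qed
  obtain u1 u2 v1 v2 where zeq: "z = ((u1, u2), (v1, v2))" by (metis surj_pair)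
  from z obtain xp xm yp ym where sp: "(u1, u2) \<in> symp_space \<alpha>" "(v1, v2) \<in> symp_space \<alpha>"
    and x: "(xp, xm) \<in> tensor_all Q" and y: "(yp, ym) \<in> tensor_all T"
    and p: "case_sum v1 yp = mat_vec g (case_sum u1 xp)"
    and m: "case_sum v2 ym = mat_vec (?c g) (case_sum u2 xm)"
    unfolding zeq char_rel_iff by blast
  have c: "?c (mat_mult (mat_mult (?e a) g) (?e b)) = mat_mult (mat_mult (?e a) (?c g)) (?e b)"
    using g a b by (simp add: contragredient_mult GL_mult_closed emb_GG emb_contragredient)
  show "z \<in> char_rel \<alpha> k (mat_mult (mat_mult (?e a) g) (?e b)) Q T"
    unfolding zeq char_rel_iff c
    using move[OF g _ _ p] move[OF contragredient_GL[OF g] _ _ m] sp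
      tensor_all_block_action[OF x O_Zp_transpose[OF b] Q] tensor_all_block_action[OF y a T]
    unfolding symp_space_def by blast
qed

text \<open>Lying in one double coset is symmetric, so the one-sided inclusion applies in both
  directions.\<close>

lemma char_rel_dcoset:
  assumes g: "g \<in> carrier (GG \<alpha> k)" and g': "g' \<in> dcoset \<alpha> k g"
    and Q: "Zp_submodule Q" "Q \<subseteq> symp_space k" and T: "Zp_submodule T" "T \<subseteq> symp_space k"
  shows "char_rel \<alpha> k g' Q T = char_rel \<alpha> k g Q T"
proof -
  obtain a b where ab: "a \<in> O_Zp" "b \<in> O_Zp" "g' = mat_mult (mat_mult (emb \<alpha> k a) g) (emb \<alpha> k b)"
    using g' unfolding dcoset_iff by blast
  then have g'_carrier: "g' \<in> carrier (GG \<alpha> k)" by (simp add: GL_mult_closed emb_GG g)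
  have "g \<in> dcoset \<alpha> k g'"
    unfolding ab(3) dcoset_absorb[OF g ab(1,2)] by (rule dcoset_refl[OF g])
  then obtain c d where cd: "c \<in> O_Zp" "d \<in> O_Zp" "g = mat_mult (mat_mult (emb \<alpha> k c) g') (emb \<alpha> k d)"
    unfolding dcoset_iff by blast
  show ?thesis
    using char_rel_subset_translate[OF g ab(1,2) Q T, folded ab(3)]
      char_rel_subset_translate[OF g'_carrier cd(1,2) Q T, folded cd(3)] by blast
qed

lemma chi_eq_char_rel:
  assumes g: "g \<in> carrier (GG \<alpha> k)"
    and Q: "Zp_submodule Q" "Q \<subseteq> symp_space k" and T: "Zp_submodule T" "T \<subseteq> symp_space k"
  shows "chi \<alpha> k (dcoset \<alpha> k g) Q T = char_rel \<alpha> k g Q T"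
  unfolding chi_def
proof (rule the_equality)
  show eq: "\<forall>m. \<forall>g'\<in>dcoset \<alpha> k g \<inter> GG_level \<alpha> k m. chi_rep \<alpha> k m g' Q T = char_rel \<alpha> k g Q T"
    using chi_rep_eq_char_rel[OF _ Q(1) T(1)] char_rel_dcoset[OF g _ Q T] by blast
  \<comment> \<open>Some level must contain \<open>g\<close>; otherwise the defining condition could
    be vacuous and would not determine \<open>R\<close>.\<close>
  obtain m where "g \<in> GG_level \<alpha> k m" using GG_level_exhaust[OF g] .
  then have gm: "g \<in> dcoset \<alpha> k g \<inter> GG_level \<alpha> k m" using dcoset_refl[OF g] by blast
  fix R assume "\<forall>m. \<forall>g'\<in>dcoset \<alpha> k g \<inter> GG_level \<alpha> k m. chi_rep \<alpha> k m g' Q T = R"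
  with eq gm show "R = char_rel \<alpha> k g Q T" by metis
qed

section \<open>Multiplicativity\<close>

text \<open>In each block \<open>shift_up\<close> moves the second \<open>N\<close> coordinates into
  the first \<open>N\<close> places; \<open>shift_down\<close> moves the first \<open>N\<close>
  coordinates into the second \<open>N\<close> places.\<close>

definition shift_up :: "nat \<Rightarrow> (nat \<times> nat \<Rightarrow> 'a) \<Rightarrow> nat \<times> nat \<Rightarrow> 'a::zero" where
  "shift_up N x = (\<lambda>(j, i). if i < N then x (j, N + i) else 0)"

definition shift_down :: "nat \<Rightarrow> (nat \<times> nat \<Rightarrow> 'a) \<Rightarrow> nat \<times> nat \<Rightarrow> 'a::zero" where
  "shift_down N x = (\<lambda>(j, i). if N \<le> i \<and> i < 2 * N then x (j, i - N) else 0)"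

lemma tensor_all_shift:
  assumes "Zp_submodule Q" "(xp, xm) \<in> tensor_all Q"
  shows "(shift_up N xp, shift_up N xm) \<in> tensor_all Q"
    and "(shift_down N xp, shift_down N xm) \<in> tensor_all Q"
proof -
  have 0: "((\<lambda>_. 0), (\<lambda>_. 0)) \<in> Q"
    using tensor_all_zero[OF assms(1)] by (simp add: tensor_all_def)
  have "((\<lambda>j. shift_up N xp (j, i)), (\<lambda>j. shift_up N xm (j, i))) \<in> Q" for i
    using assms(2) 0 by (cases "i < N") (simp_all add: tensor_all_def shift_up_def)
  then show "(shift_up N xp, shift_up N xm) \<in> tensor_all Q" by (simp add: tensor_all_def)
  have "((\<lambda>j. shift_down N xp (j, i)), (\<lambda>j. shift_down N xm (j, i))) \<in> Q" for i
    using assms(2) 0 by (cases "N \<le> i \<and> i < 2 * N") (auto simp: tensor_all_def shift_down_def)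
  then show "(shift_down N xp, shift_down N xm) \<in> tensor_all Q" by (simp add: tensor_all_def)
qed

lemma Theta_vec:
  assumes "w \<in> Qpn \<alpha>"
  shows "mat_vec (emb \<alpha> k (Theta N)) (case_sum w z)
    = case_sum w (\<lambda>(j, i). if j < k then z (j, block_swap 0 N N i) else 0)"
  by (simp add: emb_vec_block_action assms block_action_def Theta_perm_mat perm_mat_vec
      cong: if_cong)

lemma theta_product_vec:
  assumes "g \<in> carrier (GG \<alpha> k)" "h \<in> carrier (GG \<alpha> k)"
  shows "mat_vec (theta_product \<alpha> k N g h) v = mat_vec g (mat_vec (emb \<alpha> k (Theta N)) (mat_vec h v))"
  by (simp add: mat_vec_mult[of _ "index_set \<alpha> k"] finitary_mats_mult assms[THEN GL_finitary]
      emb_finitary O_ZpD(1)[OF Theta_O_Zp])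

text \<open>The witness \<open>w\<close> is the finite part of the intermediate vector
  \<open>h (u, x)\<close>. Since \<open>h\<close> leaves the second half of \<open>x\<close> alone
  and \<open>g\<close> leaves alone what \<open>Theta N\<close> puts into the second half, the
  equation separates into one for \<open>h\<close> and one for \<open>g\<close>.\<close>

lemma theta_product_split:
  assumes g: "g \<in> GG_level \<alpha> k N" and h: "h \<in> GG_level \<alpha> k N"
    and x0: "\<And>j i. j \<ge> k \<Longrightarrow> x (j, i) = 0"
    and eq: "case_sum v y = mat_vec (theta_product \<alpha> k N g h) (case_sum u x)"
  obtains w where "w \<in> Qpn \<alpha>"
    "case_sum w (shift_up N y) = mat_vec h (case_sum u (graft N x (\<lambda>_. 0)))"
    "case_sum v (graft N y (\<lambda>_. 0)) = mat_vec g (case_sum w (shift_up N x))"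
proof -
  note gon = g[unfolded GG_level_iff, THEN conjunct2] and hon = h[unfolded GG_level_iff, THEN conjunct2]
  define w where "w = mat_vec h (case_sum u x) \<circ> Inl"
  define z where "z = mat_vec h (case_sum u x) \<circ> Inr"
  define z' where "z' = (\<lambda>(j, i). if j < k then z (j, block_swap 0 N N i) else 0)"
  have wz: "case_sum w z = mat_vec h (case_sum u x)"
    by (simp add: w_def z_def comp_def surjective_sum)
  have h_out: "mat_vec h (case_sum u x) i = (if i \<in> index_set \<alpha> k then case_sum u x i else 0)"
    if "i \<notin> index_level \<alpha> k N" for i
    by (rule mat_vec_out[OF hon that])
  have "w i = 0" if "i \<ge> \<alpha>" for i
    using that h_out[of "Inl i"] unfolding w_def comp_def
    by (simp add: index_level_def index_set_def InlI image_iff Plus_def)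
  then have w: "w \<in> Qpn \<alpha>" by (simp add: Qpn_def)
  have wz': "case_sum v y = mat_vec g (case_sum w z')"
    unfolding eq theta_product_vec[OF GG_level_carrier[OF g] GG_level_carrier[OF h]]
      wz[symmetric] Theta_vec[OF w] z'_def ..
  have z_tail: "z (j, i) = x (j, i)" if "N \<le> i" for j i
    using that h_out[of "Inr (j, i)"] x0[of j i] unfolding z_def comp_def
    by (simp add: index_level_def index_set_def image_iff Plus_def)
  have z_out: "z (j, i) = 0" if "k \<le> j" for j i
    using that h_out[of "Inr (j, i)"] unfolding z_def comp_def
    by (simp add: index_level_def index_set_def image_iff Plus_def)
  have y_out: "y (j, i) = (if j < k then z' (j, i) else 0)" if "N \<le> i \<or> k \<le> j" for j i
  proof -
    have "Inr (j, i) \<notin> index_level \<alpha> k N"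
      using that by (auto simp: index_level_def)
    then have "case_sum v y (Inr (j, i)) = (if Inr (j, i) \<in> index_set \<alpha> k then case_sum w z' (Inr (j, i)) else 0)"
      unfolding wz' by (rule mat_vec_out[OF gon])
    then show ?thesis
      by (simp add: index_set_def image_iff Plus_def)
  qed
  \<comment> \<open>The first \<open>N\<close> places of \<open>z\<close> are sent to the second
    \<open>N\<close> places, where \<open>g\<close> acts trivially, and reappear in
    \<open>y\<close>.\<close>
  have 1: "graft N z (\<lambda>_. 0) = shift_up N y"
    using y_out z_out by (auto simp: fun_eq_iff graft_def shift_up_def z'_def block_swap_def)
  \<comment> \<open>The first \<open>N\<close> places of \<open>z'\<close> come from the second
    \<open>N\<close> places of \<open>z\<close>, where \<open>h\<close> has not changed
    \<open>x\<close>.\<close>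
  have 2: "graft N z' (\<lambda>_. 0) = shift_up N x"
    using z_tail x0 by (auto simp: fun_eq_iff graft_def shift_up_def z'_def block_swap_def)
  show thesis
  proof (rule that[OF w])
    show "case_sum w (shift_up N y) = mat_vec h (case_sum u (graft N x (\<lambda>_. 0)))"
      unfolding 1[symmetric] by (rule mat_vec_graft[OF h wz refl])
    show "case_sum v (graft N y (\<lambda>_. 0)) = mat_vec g (case_sum w (shift_up N x))"
      unfolding 2[symmetric] by (rule mat_vec_graft[OF g wz' refl])
  qed
qed

text \<open>The input \<open>x'\<close> of \<open>g\<close> is parked in the second half while
  \<open>h\<close> acts, and the output \<open>z\<close> of \<open>h\<close> is parked there while
  \<open>g\<close> acts.\<close>

lemma theta_product_join:
  assumes g: "g \<in> GG_level \<alpha> k N" and h: "h \<in> GG_level \<alpha> k N" and w: "w \<in> Qpn \<alpha>"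
    and x0: "\<And>j i. j \<ge> k \<Longrightarrow> x' (j, i) = 0" and z0: "\<And>j i. j \<ge> k \<Longrightarrow> z (j, i) = 0"
    and hz: "case_sum w z = mat_vec h (case_sum u x)"
    and gx: "case_sum v y = mat_vec g (case_sum w x')"
  shows "case_sum v (graft N y (shift_down N z))
    = mat_vec (theta_product \<alpha> k N g h) (case_sum u (graft N x (shift_down N x')))"
proof -
  have d: "shift_down N r (j, i) = 0" if "r (j, i - N) = 0" for r :: "nat \<times> nat \<Rightarrow> 'a padic" and j i
    using that by (simp add: shift_down_def)
  have h': "case_sum w (graft N z (shift_down N x')) = mat_vec h (case_sum u (graft N x (shift_down N x')))"
    by (rule mat_vec_graft[OF h hz]) (simp add: d x0)
  \<comment> \<open>Between \<open>h\<close> and \<open>g\<close>, the matrix \<open>Theta N\<close>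
    exchanges the two parked halves.\<close>
  have "(\<lambda>(j, i). if j < k then graft N z (shift_down N x') (j, block_swap 0 N N i) else 0)
      = graft N x' (shift_down N z)"
    using x0 z0 by (auto simp: fun_eq_iff graft_def shift_down_def block_swap_def)
  then have "mat_vec (theta_product \<alpha> k N g h) (case_sum u (graft N x (shift_down N x')))
      = mat_vec g (case_sum w (graft N x' (shift_down N z)))"
    by (simp add: theta_product_vec GG_level_carrier[OF g] GG_level_carrier[OF h] Theta_vec[OF w]
        flip: h')
  also have "\<dots> = case_sum v (graft N y (shift_down N z))"
    by (rule mat_vec_graft[OF g gx, symmetric]) (simp add: d z0)
  finally show ?thesis by simp
qed

text \<open>Splitting and joining are applied separately to the plus components and, with
  contragredients, to the minus components; the two resulting vectors \<open>w1\<close>,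
  \<open>w2\<close> form the intermediate point.\<close>

lemma char_rel_theta_product:
  assumes g: "g \<in> GG_level \<alpha> k N" and h: "h \<in> GG_level \<alpha> k N"
    and Q: "Zp_submodule Q" "Q \<subseteq> symp_space k" and T: "Zp_submodule T" "T \<subseteq> symp_space k"
  shows "char_rel \<alpha> k (theta_product \<alpha> k N g h) Q T = char_rel \<alpha> k h Q T O char_rel \<alpha> k g Q T"
proof -
  let ?c = "contragredient (index_set \<alpha> k)"
  \<comment> \<open>The contragredient fixes the embedded \<open>Theta N\<close>, so the minus
    equation has the same shape as the plus equation.\<close>
  have c: "?c (theta_product \<alpha> k N g h) = theta_product \<alpha> k N (?c g) (?c h)"
    using GG_level_carrier[OF g] GG_level_carrier[OF h]
    by (simp add: contragredient_mult GL_mult_closed emb_GG emb_contragredient Theta_O_Zp)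
  note cg = GG_level_contragredient[OF g] and ch = GG_level_contragredient[OF h]
  show ?thesis
  proof (intro equalityI subsetI)
    fix s assume s: "s \<in> char_rel \<alpha> k (theta_product \<alpha> k N g h) Q T"
    obtain u1 u2 v1 v2 where seq: "s = ((u1, u2), (v1, v2))" by (metis surj_pair)
    from s obtain xp xm yp ym where sp: "(u1, u2) \<in> symp_space \<alpha>" "(v1, v2) \<in> symp_space \<alpha>"
      and x: "(xp, xm) \<in> tensor_all Q" and y: "(yp, ym) \<in> tensor_all T"
      and p: "case_sum v1 yp = mat_vec (theta_product \<alpha> k N g h) (case_sum u1 xp)"
      and m: "case_sum v2 ym = mat_vec (theta_product \<alpha> k N (?c g) (?c h)) (case_sum u2 xm)"
      unfolding seq char_rel_iff c by blast
    obtain w1 where w1: "w1 \<in> Qpn \<alpha>"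
      "case_sum w1 (shift_up N yp) = mat_vec h (case_sum u1 (graft N xp (\<lambda>_. 0)))"
      "case_sum v1 (graft N yp (\<lambda>_. 0)) = mat_vec g (case_sum w1 (shift_up N xp))"
      using theta_product_split[OF g h _ p] tensor_all_vanish[OF x Q(2)] by blast
    obtain w2 where w2: "w2 \<in> Qpn \<alpha>"
      "case_sum w2 (shift_up N ym) = mat_vec (?c h) (case_sum u2 (graft N xm (\<lambda>_. 0)))"
      "case_sum v2 (graft N ym (\<lambda>_. 0)) = mat_vec (?c g) (case_sum w2 (shift_up N xm))"
      using theta_product_split[OF cg ch _ m] tensor_all_vanish[OF x Q(2)] by blast
    have w: "(w1, w2) \<in> symp_space \<alpha>" using w1 w2 by (simp add: symp_space_def)
    have "((u1, u2), (w1, w2)) \<in> char_rel \<alpha> k h Q T"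
      unfolding char_rel_iff
      using sp w w1(2) w2(2) tensor_all_graft[OF x tensor_all_zero[OF Q(1)]] tensor_all_shift(1)[OF T(1) y]
      by blast
    moreover have "((w1, w2), (v1, v2)) \<in> char_rel \<alpha> k g Q T"
      unfolding char_rel_iff
      using sp w w1(3) w2(3) tensor_all_graft[OF y tensor_all_zero[OF T(1)]] tensor_all_shift(1)[OF Q(1) x]
      by blast
    ultimately show "s \<in> char_rel \<alpha> k h Q T O char_rel \<alpha> k g Q T"
      unfolding seq by (rule relcompI)
  next
    fix s assume "s \<in> char_rel \<alpha> k h Q T O char_rel \<alpha> k g Q T"
    then obtain u1 u2 w1 w2 v1 v2 where seq: "s = ((u1, u2), (v1, v2))"
      and hs: "((u1, u2), (w1, w2)) \<in> char_rel \<alpha> k h Q T"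
      and gs: "((w1, w2), (v1, v2)) \<in> char_rel \<alpha> k g Q T"
      by (metis relcompE surj_pair)
    from hs obtain xp xm zp zm where u: "(u1, u2) \<in> symp_space \<alpha>" and w: "(w1, w2) \<in> symp_space \<alpha>"
      and x: "(xp, xm) \<in> tensor_all Q" and z: "(zp, zm) \<in> tensor_all T"
      and hp: "case_sum w1 zp = mat_vec h (case_sum u1 xp)"
      and hm: "case_sum w2 zm = mat_vec (?c h) (case_sum u2 xm)"
      unfolding char_rel_iff by blast
    from gs obtain xp' xm' yp ym where v: "(v1, v2) \<in> symp_space \<alpha>"
      and x': "(xp', xm') \<in> tensor_all Q" and y: "(yp, ym) \<in> tensor_all T"
      and gp: "case_sum v1 yp = mat_vec g (case_sum w1 xp')"
      and gm: "case_sum v2 ym = mat_vec (?c g) (case_sum w2 xm')"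
      unfolding char_rel_iff by blast
    have "w1 \<in> Qpn \<alpha>" "w2 \<in> Qpn \<alpha>" using w by (simp_all add: symp_space_def)
    then have "case_sum v1 (graft N yp (shift_down N zp))
        = mat_vec (theta_product \<alpha> k N g h) (case_sum u1 (graft N xp (shift_down N xp')))"
      "case_sum v2 (graft N ym (shift_down N zm))
        = mat_vec (theta_product \<alpha> k N (?c g) (?c h)) (case_sum u2 (graft N xm (shift_down N xm')))"
      using theta_product_join[OF g h _ _ _ hp gp] theta_product_join[OF cg ch _ _ _ hm gm]
        tensor_all_vanish[OF x' Q(2)] tensor_all_vanish[OF z T(2)] by blast+
    then show "s \<in> char_rel \<alpha> k (theta_product \<alpha> k N g h) Q T"
      unfolding seq char_rel_iff c
      using u v tensor_all_graft[OF x tensor_all_shift(2)[OF Q(1) x']]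
        tensor_all_graft[OF y tensor_all_shift(2)[OF T(1) z]]
      by blast
  qed
qed

theorem theorem4p6:
  fixes \<alpha> k :: nat
    and \<gg> \<hh> :: "(index \<Rightarrow> index \<Rightarrow> 'p::prime_card padic) set"
    and Q T :: "('p pvec \<times> 'p pvec) set"
  assumes "k \<ge> 1"
    and "\<gg> \<in> double_cosets \<alpha> k" and "\<hh> \<in> double_cosets \<alpha> k"
    and "self_dual k Q" and "self_dual k T"
  shows "chi \<alpha> k (star \<alpha> k \<gg> \<hh>) Q T = relation_product (chi \<alpha> k \<gg> Q T) (chi \<alpha> k \<hh> Q T)"
proof -
  have Q: "Zp_submodule Q" "Q \<subseteq> symp_space k" and T: "Zp_submodule T" "T \<subseteq> symp_space k"
    using assms(4,5) by (simp_all add: self_dual_def)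
  obtain g h where g: "g \<in> carrier (GG \<alpha> k)" "\<gg> = dcoset \<alpha> k g"
    and h: "h \<in> carrier (GG \<alpha> k)" "\<hh> = dcoset \<alpha> k h"
    using assms(2,3) by (auto simp: double_cosets_def)
  obtain m n where "g \<in> GG_level \<alpha> k m" "h \<in> GG_level \<alpha> k n"
    using GG_level_exhaust g(1) h(1) by metis
  \<comment> \<open>A common level is needed, since it also serves as the index of
    \<open>Theta\<close> in the representative of the product.\<close>
  then have gN: "g \<in> GG_level \<alpha> k (max m n)" and hN: "h \<in> GG_level \<alpha> k (max m n)"
    by (auto intro: GG_level_mono)
  show ?thesis
    using chi_eq_char_rel[OF g(1) Q T] chi_eq_char_rel[OF h(1) Q T]
      chi_eq_char_rel[OF theta_product_GG[OF g(1) h(1)] Q T] char_rel_theta_product[OF gN hN Q T]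
    by (simp add: g(2) h(2) star_eq[OF gN hN] relation_product_def)
qed

end
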